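(* Let $0<a<b<\infty$, $\Delta=[a,b]$, $\Psi\in C^{1}(\Delta,\mathbb{R})$ increasing with $\Psi'\neq0$ on $\Delta$, $0<\mu<1$, $0\le\nu\le1$, $\rho=\mu+\nu-\mu\nu$. Let $f:(a,b]\times\mathbb{R}\to\mathbb{R}$ be such that $f(\cdot,y(\cdot))\in\mathbf{C}_{1-\rho;\Psi}(\Delta,\mathbb{R})$ for every $y\in\mathbf{C}_{1-\rho;\Psi}(\Delta,\mathbb{R})$ and $|f(t,y_1)-f(t,y_2)|\le L|y_1-y_2|$ for all $t\in(a,b]$, $y_1,y_2\in\mathbb{R}$, where $L>0$ is a constant. Then for every $\epsilon>0$, if $y^*\in\mathbf{C}_{1-\rho;\Psi}(\Delta,\mathbb{R})$ satisfies $$\left|^H\mathbf{D}^{\mu,\nu;\Psi}_{a^+}y^*(t)-f(t,y^*(t))\right|\le\epsilon,\quad t\in\Delta,$$ then there exists a solution $y\in\mathbf{C}_{1-\rho;\Psi}(\Delta,\mathbb{R})$ of $^H\mathbf{D}^{\mu,\nu;\Psi}_{a^+}y(t)=f(t,y(t))$ with $\mathbf{I}^{1-\rho;\Psi}_{a^+}y^*(a)=\mathbf{I}^{1-\rho;\Psi}_{a^+}y(a)$ such that $$\|y^*-y\|_{\mathbf{C}_{1-\rho;\Psi}}\le\left(\frac{E_\mu\big(L(\Psi(b)-\Psi(a))^\mu\big)-1}{L}(\Psi(b)-\Psi(a))^{1-\rho}\right)\epsilon.$$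
   Context: $\mathbf{C}_{1-\rho;\Psi}(\Delta,\mathbb{R})=\{h:(a,b]\to\mathbb{R}: (\Psi(t)-\Psi(a))^{1-\rho}h(t)\in C(\Delta,\mathbb{R})\}$ with norm $\|h\|_{\mathbf{C}_{1-\rho;\Psi}}=\max_{t\in\Delta}|(\Psi(t)-\Psi(a))^{1-\rho}h(t)|$. $\mathbf{I}^{\alpha;\Psi}_{a^+}h(t)=\frac{1}{\Gamma(\alpha)}\int_a^t\Psi'(\eta)(\Psi(t)-\Psi(\eta))^{\alpha-1}h(\eta)\,d\eta$ for $\alpha>0$. $^H\mathbf{D}^{\mu,\nu;\Psi}_{a^+}h=\mathbf{I}^{\nu(1-\mu);\Psi}_{a^+}\left(\frac{1}{\Psi'(t)}\frac{d}{dt}\right)\mathbf{I}^{(1-\nu)(1-\mu);\Psi}_{a^+}h$ ($\Psi$-Hilfer derivative). A solution $y$ of the equation with $\mathbf{I}^{1-\rho;\Psi}_{a^+}y(a)=c$ is a $y\in\mathbf{C}_{1-\rho;\Psi}(\Delta,\mathbb{R})$ satisfying $y(t)=\frac{(\Psi(t)-\Psi(a))^{\rho-1}}{\Gamma(\rho)}c+\mathbf{I}^{\mu;\Psi}_{a^+}f(\cdot,y(\cdot))(t)$ on $(a,b]$. $E_\mu(z)=\sum_{k=0}^\infty\frac{z^k}{\Gamma(k\mu+1)}$ is the one-parameter Mittag-Leffler function. *)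

theory Defs
  imports "HOL-Analysis.Analysis"
begin

definition wC :: "(real \<Rightarrow> real) \<Rightarrow> real \<Rightarrow> real \<Rightarrow> real \<Rightarrow> (real \<Rightarrow> real) \<Rightarrow> bool" where
  "wC \<Psi> a b \<rho> h \<longleftrightarrow>
     (\<exists>g. continuous_on {a..b} g \<and> (\<forall>t\<in>{a<..b}. g t = (\<Psi> t - \<Psi> a) powr (1 - \<rho>) * h t))"

text \<open>Weighted norm: max over [a,b] of the continuous extension = sup over (a,b].\<close>
definition wC_norm :: "(real \<Rightarrow> real) \<Rightarrow> real \<Rightarrow> real \<Rightarrow> real \<Rightarrow> (real \<Rightarrow> real) \<Rightarrow> real" where
  "wC_norm \<Psi> a b \<rho> h = (SUP t\<in>{a<..b}. \<bar>(\<Psi> t - \<Psi> a) powr (1 - \<rho>) * h t\<bar>)"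

definition frac_int :: "real \<Rightarrow> (real \<Rightarrow> real) \<Rightarrow> (real \<Rightarrow> real) \<Rightarrow> real \<Rightarrow> (real \<Rightarrow> real) \<Rightarrow> real \<Rightarrow> real" where
  "frac_int \<alpha> \<Psi> \<Psi>' a h t =
     (if \<alpha> = 0 then h t
      else (1 / Gamma \<alpha>) * integral {a..t} (\<lambda>\<eta>. \<Psi>' \<eta> * (\<Psi> t - \<Psi> \<eta>) powr (\<alpha> - 1) * h \<eta>))"

definition frac_integrable :: "real \<Rightarrow> (real \<Rightarrow> real) \<Rightarrow> (real \<Rightarrow> real) \<Rightarrow> real \<Rightarrow> (real \<Rightarrow> real) \<Rightarrow> real \<Rightarrow> bool" where
  "frac_integrable \<alpha> \<Psi> \<Psi>' a h t \<longleftrightarrow>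
     \<alpha> = 0 \<or> (\<lambda>\<eta>. \<Psi>' \<eta> * (\<Psi> t - \<Psi> \<eta>) powr (\<alpha> - 1) * h \<eta>) integrable_on {a..t}"

definition hilfer :: "real \<Rightarrow> real \<Rightarrow> (real \<Rightarrow> real) \<Rightarrow> (real \<Rightarrow> real) \<Rightarrow> real \<Rightarrow> real \<Rightarrow> (real \<Rightarrow> real) \<Rightarrow> real \<Rightarrow> real" where
  "hilfer \<mu> \<nu> \<Psi> \<Psi>' a b h t =
     frac_int (\<nu> * (1 - \<mu>)) \<Psi> \<Psi>' a
       (\<lambda>s. (1 / \<Psi>' s) * vector_derivative (frac_int ((1 - \<nu>) * (1 - \<mu>)) \<Psi> \<Psi>' a h) (at s within {a..b})) t"

definition hilfer_exists :: "real \<Rightarrow> real \<Rightarrow> (real \<Rightarrow> real) \<Rightarrow> (real \<Rightarrow> real) \<Rightarrow> real \<Rightarrow> real \<Rightarrow> (real \<Rightarrow> real) \<Rightarrow> bool" where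
  "hilfer_exists \<mu> \<nu> \<Psi> \<Psi>' a b h \<longleftrightarrow>
     (\<forall>s\<in>{a<..b}. frac_int ((1 - \<nu>) * (1 - \<mu>)) \<Psi> \<Psi>' a h differentiable (at s within {a..b})) \<and>
     (\<forall>t\<in>{a<..b}. frac_integrable (\<nu> * (1 - \<mu>)) \<Psi> \<Psi>' a
        (\<lambda>s. (1 / \<Psi>' s) * vector_derivative (frac_int ((1 - \<nu>) * (1 - \<mu>)) \<Psi> \<Psi>' a h) (at s within {a..b})) t)"

definition mittag_leffler :: "real \<Rightarrow> real \<Rightarrow> real" where
  "mittag_leffler \<mu> z = (\<Sum>k. z ^ k / Gamma (real k * \<mu> + 1))"

end

theory Submission
  imports Defs
begin

text \<open>
  In the variable \<open>x = \<Psi> t - \<Psi> a\<close> a weighted continuous function is \<open>x powr (\<rho> - 1) * g x\<close> with \<open>g\<close>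
  continuous, and the fractional integral of order \<open>\<alpha>\<close> turns \<open>x powr (p - 1) * g x\<close> into
  \<open>x powr (\<alpha> + p - 1)\<close> times the Erdelyi-Kober integral of \<open>g\<close>. The latter is a bounded operator on
  continuous functions, and its semigroup law follows from the case of powers by Weierstrass
  approximation.

  Let \<open>\<beta> = \<rho> - \<mu>\<close> and let \<open>\<Phi>\<close> be the fractional integral of order \<open>1 - \<rho>\<close> of \<open>y*\<close>. The derivative of \<open>\<Phi>\<close>
  need not be Lebesgue integrable, so the Hilfer derivative is first rewritten, by parts, as a Marchaud
  integral; in this form it is the right-hand derivative of the fractional integral of order \<open>\<beta>\<close> of
  \<open>\<Phi> - \<Phi> 0\<close>. The hypothesis then says that \<open>D = I\<^sup>\<beta> (\<Phi> - \<Phi> 0) - I\<^sup>1 f(\<cdot>, y*)\<close> is \<open>\<epsilon>\<close>-Lipschitz with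
  \<open>D 0 = 0\<close>. Since \<open>I\<^sup>\<mu> D\<close> is the primitive of the defect of the integral equation, that defect is at most
  \<open>\<epsilon> * x powr \<mu> / Gamma (\<mu> + 1)\<close>. Finally, Picard's iteration started at \<open>y*\<close> converges to a solution, and
  its increments are bounded by the terms of the Mittag-Leffler series.
\<close>


section \<open>Erdelyi-Kober integrals\<close>

text \<open>The substitution \<open>s = x * u\<close> moves the fractional integral of
  \<open>s powr (p - 1) * g s\<close> from \<open>{0..x}\<close> to the fixed interval
  \<open>{0..1}\<close>; the factor \<open>x powr (\<alpha> + p - 1)\<close> is split off, so that
  \<open>x = 0\<close> is a regular point. Order 0 is the identity and has its own case because both
  \<open>1 - \<rho>\<close> and \<open>\<rho> - \<mu>\<close> may be 0.\<close>

definition ek_int :: "real \<Rightarrow> real \<Rightarrow> (real \<Rightarrow> real) \<Rightarrow> real \<Rightarrow> real" where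
  "ek_int \<alpha> p g x =
     (if \<alpha> = 0 then g x
      else integral {0..1} (\<lambda>u. (1 - u) powr (\<alpha> - 1) * u powr (p - 1) * g (x * u)) / Gamma \<alpha>)"

lemma has_integral_beta_kernel:
  fixes \<alpha> p :: real
  assumes "0 < \<alpha>" "0 < p"
  shows "((\<lambda>u. (1 - u) powr (\<alpha> - 1) * u powr (p - 1)) has_integral
            Gamma \<alpha> * (Gamma p / Gamma (p + \<alpha>))) {0..1}"
  using has_integral_Beta_real[OF assms(2) assms(1)] by (simp add: Beta_def mult_ac)

lemma beta_kernel_absolutely_integrable:
  fixes \<alpha> p :: real
  assumes "0 < \<alpha>" "0 < p"
  shows "(\<lambda>u. (1 - u) powr (\<alpha> - 1) * u powr (p - 1)) absolutely_integrable_on {0..1}"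
  by (rule nonnegative_absolutely_integrable_1)
     (use has_integral_beta_kernel[OF assms] in \<open>auto simp: integrable_on_def\<close>)

lemma beta_kernel_mult_absolutely_integrable:
  fixes \<alpha> p :: real
  assumes "0 < \<alpha>" "0 < p" "continuous_on {0..1} h"
  shows "(\<lambda>u. (1 - u) powr (\<alpha> - 1) * u powr (p - 1) * h u) absolutely_integrable_on {0..1}"
proof -
  have "(\<lambda>u. h u * ((1 - u) powr (\<alpha> - 1) * u powr (p - 1))) absolutely_integrable_on {0..1}"
  proof (rule absolutely_integrable_bounded_measurable_product_real)
    show "h \<in> borel_measurable (lebesgue_on {0..1})"
      using assms(3) by (intro continuous_imp_measurable_on_sets_lebesgue) auto
    show "bounded (h ` {0..1})"
      using assms(3) by (intro compact_imp_bounded compact_continuous_image) auto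
  qed (use beta_kernel_absolutely_integrable[OF assms(1,2)] in auto)
  then show ?thesis by (simp add: mult_ac)
qed

lemma continuous_on_scaled_arg:
  fixes g :: "real \<Rightarrow> 'b::topological_space"
  assumes "continuous_on {0..B} g" "0 \<le> x" "x \<le> B"
  shows "continuous_on {0..1} (\<lambda>u. g (x * u))"
proof -
  have "x * u \<le> B" if "0 \<le> u" "u \<le> 1" for u
    using mult_left_mono[OF that(2) assms(2)] assms(3) by simp
  then show ?thesis
    using assms by (intro continuous_on_compose2[OF assms(1)]) (auto intro!: continuous_intros)
qed

text \<open>The kernel is nonnegative, so the pointwise bound passes under the integral, and
  \<open>u powr q\<close> only shifts \<open>p\<close> to \<open>p + q\<close> in the Beta integral.
  Allowing two functions at two points lets one estimate serve for continuity, for sup norm bounds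
  and for Lipschitz increments. At \<open>u = 0\<close> the kernel is 0, since
  \<open>0 powr z = 0\<close>.\<close>

lemma ek_int_diff_bound:
  assumes "0 \<le> \<alpha>" "0 < p" "0 \<le> q"
    and "continuous_on {0..1} (\<lambda>u. g (x * u))" "continuous_on {0..1} (\<lambda>u. h (y * u))"
    and le: "\<And>u. 0 < u \<Longrightarrow> u \<le> 1 \<Longrightarrow> \<bar>g (x * u) - h (y * u)\<bar> \<le> C * u powr q"
  shows "\<bar>ek_int \<alpha> p g x - ek_int \<alpha> p h y\<bar> \<le> C * (Gamma (p + q) / Gamma (p + q + \<alpha>))"
proof (cases "\<alpha> = 0")
  case True
  have "Gamma (p + q) > 0" using assms by (intro Gamma_real_pos) auto
  then show ?thesis using True le[of 1] by (simp add: ek_int_def)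
next
  case False
  let ?k = "\<lambda>u. (1 - u) powr (\<alpha> - 1) * u powr (p - 1)"
  have \<alpha>: "0 < \<alpha>" using False assms by simp
  have G: "Gamma \<alpha> > 0" using \<alpha> by (rule Gamma_real_pos)
  have i1: "(\<lambda>u. ?k u * g (x * u)) integrable_on {0..1}"
    and i2: "(\<lambda>u. ?k u * h (y * u)) integrable_on {0..1}"
    using beta_kernel_mult_absolutely_integrable[OF \<alpha> assms(2)] assms(4,5)
    by (auto intro: set_lebesgue_integral_eq_integral)
  have hi: "((\<lambda>u. C * ((1 - u) powr (\<alpha> - 1) * u powr (p + q - 1))) has_integral
            C * (Gamma \<alpha> * (Gamma (p + q) / Gamma (p + q + \<alpha>)))) {0..1}"
    using assms \<alpha> by (intro has_integral_mult_right has_integral_beta_kernel) auto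
  have "norm (integral {0..1} (\<lambda>u. ?k u * g (x * u) - ?k u * h (y * u)))
      \<le> integral {0..1} (\<lambda>u. C * ((1 - u) powr (\<alpha> - 1) * u powr (p + q - 1)))"
  proof (rule integral_norm_bound_integral)
    show "(\<lambda>u. ?k u * g (x * u) - ?k u * h (y * u)) integrable_on {0..1}"
      by (intro integrable_diff i1 i2)
    show "(\<lambda>u. C * ((1 - u) powr (\<alpha> - 1) * u powr (p + q - 1))) integrable_on {0..1}"
      using hi by blast
    fix u :: real assume u: "u \<in> {0..1}"
    show "norm (?k u * g (x * u) - ?k u * h (y * u)) \<le> C * ((1 - u) powr (\<alpha> - 1) * u powr (p + q - 1))"
    proof (cases "u = 0")
      case True then show ?thesis by simp
    next
      case False
      have "norm (?k u * g (x * u) - ?k u * h (y * u)) = ?k u * \<bar>g (x * u) - h (y * u)\<bar>"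
        by (simp add: abs_mult flip: right_diff_distrib)
      also have "\<dots> \<le> ?k u * (C * u powr q)"
        using le[of u] u False by (intro mult_left_mono) auto
      also have "\<dots> = C * ((1 - u) powr (\<alpha> - 1) * (u powr (p - 1) * u powr q))" by simp
      also have "u powr (p - 1) * u powr q = u powr (p + q - 1)"
        by (simp add: powr_add[symmetric] algebra_simps)
      finally show ?thesis .
    qed
  qed
  also have "\<dots> = C * (Gamma \<alpha> * (Gamma (p + q) / Gamma (p + q + \<alpha>)))"
    using hi by (rule integral_unique)
  finally have "\<bar>integral {0..1} (\<lambda>u. ?k u * g (x * u)) - integral {0..1} (\<lambda>u. ?k u * h (y * u))\<bar>
      \<le> Gamma \<alpha> * (C * (Gamma (p + q) / Gamma (p + q + \<alpha>)))"
    using integral_diff[OF i1 i2] by (simp add: mult_ac)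
  then have "\<bar>integral {0..1} (\<lambda>u. ?k u * g (x * u)) - integral {0..1} (\<lambda>u. ?k u * h (y * u))\<bar> / Gamma \<alpha>
      \<le> C * (Gamma (p + q) / Gamma (p + q + \<alpha>))"
    using G by (simp only: pos_divide_le_eq mult.commute)
  then show ?thesis
    using False G by (simp add: ek_int_def flip: diff_divide_distrib)
qed

lemma ek_int_zero [simp]: "ek_int \<alpha> p (\<lambda>s. 0) x = 0"
  by (simp add: ek_int_def)

text \<open>Comparison with the zero function: \<open>(x * u) powr q\<close> splits into
  \<open>x powr q * u powr q\<close>, and the first factor joins the constant.\<close>

lemma ek_int_bound:
  assumes "0 \<le> \<alpha>" "0 < p" "0 \<le> q" "continuous_on {0..B} g" "0 < x" "x \<le> B"
    and le: "\<And>s. 0 < s \<Longrightarrow> s \<le> x \<Longrightarrow> \<bar>g s\<bar> \<le> C * s powr q"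
  shows "\<bar>ek_int \<alpha> p g x\<bar> \<le> C * x powr q * (Gamma (p + q) / Gamma (p + q + \<alpha>))"
proof -
  have "\<bar>ek_int \<alpha> p g x - ek_int \<alpha> p (\<lambda>s. 0) 0\<bar> \<le> C * x powr q * (Gamma (p + q) / Gamma (p + q + \<alpha>))"
  proof (rule ek_int_diff_bound)
    show "continuous_on {0..1} (\<lambda>u. g (x * u))"
      using assms by (intro continuous_on_scaled_arg) auto
    fix u :: real assume "0 < u" "u \<le> 1"
    then show "\<bar>g (x * u) - 0\<bar> \<le> C * x powr q * u powr q"
      using le[of "x * u"] assms by (simp add: powr_mult mult_left_le)
  qed (use assms in auto)
  then show ?thesis by simp
qed

text \<open>The point enters only through the argument \<open>x * u\<close>, and
  \<open>\<bar>y * u - x * u\<bar> \<le> \<bar>y - x\<bar>\<close>, so uniform continuity of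
  \<open>g\<close> gives a modulus valid for all \<open>u\<close> at once.\<close>

lemma continuous_on_ek_int:
  assumes "0 \<le> \<alpha>" "0 < p" "continuous_on {0..B} g"
  shows "continuous_on {0..B} (ek_int \<alpha> p g)"
proof (rule continuous_onI)
  fix x e :: real assume x: "x \<in> {0..B}" and e: "0 < e"
  define K where "K = Gamma p / Gamma (p + \<alpha>)"
  have K: "K > 0" unfolding K_def using assms by (intro divide_pos_pos Gamma_real_pos) auto
  have "uniformly_continuous_on {0..B} g"
    using assms by (intro compact_uniformly_continuous) auto
  then obtain d where d: "d > 0"
    "\<And>x y. x \<in> {0..B} \<Longrightarrow> y \<in> {0..B} \<Longrightarrow> dist y x < d \<Longrightarrow> dist (g y) (g x) < e / (2 * K)"
    using uniformly_continuous_onE[of "{0..B}" g "e / (2 * K)"] e K by (metis divide_pos_pos mult_pos_pos zero_less_numeral)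
  have "dist (ek_int \<alpha> p g y) (ek_int \<alpha> p g x) \<le> e" if y: "y \<in> {0..B}" "dist y x < d" for y
  proof -
    have "\<bar>ek_int \<alpha> p g y - ek_int \<alpha> p g x\<bar> \<le> e / (2 * K) * (Gamma (p + 0) / Gamma (p + 0 + \<alpha>))"
    proof (rule ek_int_diff_bound)
      show "continuous_on {0..1} (\<lambda>u. g (y * u))" "continuous_on {0..1} (\<lambda>u. g (x * u))"
        using assms x y by (auto intro: continuous_on_scaled_arg)
      fix u :: real assume u: "0 < u" "u \<le> 1"
      have "y * u \<in> {0..B}" "x * u \<in> {0..B}"
        using x y u mult_left_mono[of u 1 y] mult_left_mono[of u 1 x] by auto
      moreover have "dist (y * u) (x * u) < d"
        using y u mult_left_mono[of u 1 "\<bar>y - x\<bar>"]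
        by (simp add: dist_real_def abs_mult flip: left_diff_distrib)
      ultimately have "dist (g (y * u)) (g (x * u)) < e / (2 * K)" using d(2) by blast
      then show "\<bar>g (y * u) - g (x * u)\<bar> \<le> e / (2 * K) * u powr 0"
        using u by (simp add: dist_real_def)
    qed (use assms in auto)
    also have "\<dots> \<le> e" using K e by (simp add: K_def[symmetric])
    finally show ?thesis by (simp add: dist_real_def)
  qed
  then show "\<exists>d>0. \<forall>x'\<in>{0..B}. dist x' x < d \<longrightarrow> dist (ek_int \<alpha> p g x') (ek_int \<alpha> p g x) \<le> e"
    using d(1) by blast
qed

text \<open>The factor \<open>u ^ k\<close> turns the kernel into the Beta kernel with
  \<open>p + k\<close>. Monomials are thus eigenfunctions, and composing operators multiplies Gamma
  quotients.\<close>

lemma ek_int_power: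
  assumes "0 \<le> \<alpha>" "0 < p"
  shows "ek_int \<alpha> p (\<lambda>s. s ^ k) x = x ^ k * (Gamma (p + k) / Gamma (p + k + \<alpha>))"
proof (cases "\<alpha> = 0")
  case True
  have "Gamma (p + k) > 0" using assms by (intro Gamma_real_pos) auto
  then show ?thesis using True by (simp add: ek_int_def)
next
  case False
  then have "Gamma \<alpha> > 0" using assms by (intro Gamma_real_pos) auto
  have "((\<lambda>u. x ^ k * ((1 - u) powr (\<alpha> - 1) * u powr (p + k - 1))) has_integral
            x ^ k * (Gamma \<alpha> * (Gamma (p + k) / Gamma (p + k + \<alpha>)))) {0..1}"
    using assms False by (intro has_integral_mult_right has_integral_beta_kernel) auto
  moreover have "x ^ k * ((1 - u) powr (\<alpha> - 1) * u powr (p + k - 1))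
      = (1 - u) powr (\<alpha> - 1) * u powr (p - 1) * (x * u) ^ k" if "u \<in> {0..1} - {0}" for u
  proof -
    have "u powr (p + k - 1) = u powr (p - 1 + real k)" by (simp add: algebra_simps)
    also have "\<dots> = u powr (p - 1) * u ^ k" using that by (simp add: powr_add powr_realpow)
    finally show ?thesis by (simp add: power_mult_distrib)
  qed
  ultimately have "((\<lambda>u. (1 - u) powr (\<alpha> - 1) * u powr (p - 1) * (x * u) ^ k) has_integral
            x ^ k * (Gamma \<alpha> * (Gamma (p + k) / Gamma (p + k + \<alpha>)))) {0..1}"
    by (metis (no_types, lifting) has_integral_spike negligible_sing)
  then have "integral {0..1} (\<lambda>u. (1 - u) powr (\<alpha> - 1) * u powr (p - 1) * (x * u) ^ k)
    = x ^ k * (Gamma \<alpha> * (Gamma (p + k) / Gamma (p + k + \<alpha>)))"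
    by (rule integral_unique)
  then show ?thesis using False \<open>Gamma \<alpha> > 0\<close> by (simp add: ek_int_def)
qed

lemma ek_int_cmult: "ek_int \<alpha> p (\<lambda>s. c * g s) x = c * ek_int \<alpha> p g x"
  using integral_mult_right[of "{0..1}" c
      "\<lambda>u. (1 - u) powr (\<alpha> - 1) * u powr (p - 1) * g (x * u)"]
  by (simp add: ek_int_def mult_ac)

lemma ek_int_const:
  assumes "0 \<le> \<alpha>" "0 < p"
  shows "ek_int \<alpha> p (\<lambda>s. c) x = c * (Gamma p / Gamma (p + \<alpha>))"
  using ek_int_cmult[of \<alpha> p c "\<lambda>s. 1" x] ek_int_power[OF assms, of 0 x] by simp

lemma ek_int_at_zero:
  assumes "0 \<le> \<alpha>" "0 < p"
  shows "ek_int \<alpha> p g 0 = g 0 * (Gamma p / Gamma (p + \<alpha>))"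
proof -
  have "ek_int \<alpha> p g 0 = ek_int \<alpha> p (\<lambda>s. g 0) 0" by (simp add: ek_int_def)
  then show ?thesis using ek_int_const[OF assms] by simp
qed

lemma ek_int_add:
  assumes "0 \<le> \<alpha>" "0 < p" "continuous_on {0..B} g" "continuous_on {0..B} h" "0 \<le> x" "x \<le> B"
  shows "ek_int \<alpha> p (\<lambda>s. g s + h s) x = ek_int \<alpha> p g x + ek_int \<alpha> p h x"
proof (cases "\<alpha> = 0")
  case False
  let ?k = "\<lambda>u. (1 - u) powr (\<alpha> - 1) * u powr (p - 1)"
  have \<alpha>: "0 < \<alpha>" using False assms by simp
  have i1: "(\<lambda>u. ?k u * g (x * u)) integrable_on {0..1}"
    and i2: "(\<lambda>u. ?k u * h (x * u)) integrable_on {0..1}"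
    using beta_kernel_mult_absolutely_integrable[OF \<alpha> assms(2)]
      continuous_on_scaled_arg[OF assms(3,5,6)] continuous_on_scaled_arg[OF assms(4,5,6)]
    by (auto intro: set_lebesgue_integral_eq_integral)
  show ?thesis
    using integral_add[OF i1 i2] False by (simp add: ek_int_def ring_distribs add_divide_distrib)
qed (simp add: ek_int_def)

lemma ek_int_diff:
  assumes "0 \<le> \<alpha>" "0 < p" "continuous_on {0..B} g" "continuous_on {0..B} h" "0 \<le> x" "x \<le> B"
  shows "ek_int \<alpha> p (\<lambda>s. g s - h s) x = ek_int \<alpha> p g x - ek_int \<alpha> p h x"
proof -
  have "ek_int \<alpha> p (\<lambda>s. g s + (- 1) * h s) x = ek_int \<alpha> p g x + ek_int \<alpha> p (\<lambda>s. (- 1) * h s) x"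
    using assms by (intro ek_int_add continuous_intros) auto
  then show ?thesis unfolding ek_int_cmult by simp
qed

lemma ek_int_poly:
  assumes "0 \<le> \<alpha>" "0 < p" "0 \<le> x"
  shows "ek_int \<alpha> p (\<lambda>s. \<Sum>i\<le>n. c i * s ^ i) x
     = (\<Sum>i\<le>n. (c i * (Gamma (p + i) / Gamma (p + i + \<alpha>))) * x ^ i)"
proof (induction n)
  case 0
  show ?case using ek_int_const[OF assms(1,2)] by simp
next
  case (Suc n)
  have "ek_int \<alpha> p (\<lambda>s. (\<Sum>i\<le>n. c i * s ^ i) + c (Suc n) * s ^ Suc n) x
      = ek_int \<alpha> p (\<lambda>s. \<Sum>i\<le>n. c i * s ^ i) x + ek_int \<alpha> p (\<lambda>s. c (Suc n) * s ^ Suc n) x"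
    by (rule ek_int_add[of _ _ x]) (use assms in \<open>auto intro!: continuous_intros\<close>)
  then show ?case
    using Suc.IH ek_int_power[OF assms(1,2), of "Suc n" x]
    by (simp add: ek_int_cmult[of _ _ "c (Suc n)"] mult_ac del: power_Suc)
qed


lemma ek_int_cong:
  assumes "0 \<le> x" "\<And>s. 0 \<le> s \<Longrightarrow> s \<le> x \<Longrightarrow> g s = h s"
  shows "ek_int \<alpha> p g x = ek_int \<alpha> p h x"
proof -
  have "g (x * u) = h (x * u)" if "u \<in> {0..1}" for u
    using assms that mult_left_mono[of u 1 x] by auto
  then show ?thesis
    using assms unfolding ek_int_def by (auto intro!: arg_cong2[where f = "(/)"] integral_cong)
qed

lemma ek_int_uniform_bound:
  assumes "0 \<le> \<alpha>" "0 < p" "continuous_on {0..B} g" "continuous_on {0..B} h" "0 \<le> x" "x \<le> B"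
    and "\<And>s. 0 \<le> s \<Longrightarrow> s \<le> B \<Longrightarrow> \<bar>g s - h s\<bar> \<le> C"
  shows "\<bar>ek_int \<alpha> p g x - ek_int \<alpha> p h x\<bar> \<le> C * (Gamma p / Gamma (p + \<alpha>))"
proof -
  have "\<bar>ek_int \<alpha> p g x - ek_int \<alpha> p h x\<bar> \<le> C * (Gamma (p + 0) / Gamma (p + 0 + \<alpha>))"
  proof (rule ek_int_diff_bound)
    fix u :: real assume "0 < u" "u \<le> 1"
    then show "\<bar>g (x * u) - h (x * u)\<bar> \<le> C * u powr 0"
      using assms(7)[of "x * u"] assms(5,6) mult_left_mono[of u 1 x] by auto
  qed (use assms continuous_on_scaled_arg in auto)
  then show ?thesis by simp
qed

text \<open>On powers the semigroup law is the cancellation of Gamma factors; polynomials are dense.\<close>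

lemma ek_int_semigroup:
  assumes "0 \<le> \<alpha>" "0 \<le> \<gamma>" "0 < p" "continuous_on {0..B} g" "0 \<le> x" "x \<le> B"
  shows "ek_int \<gamma> (p + \<alpha>) (ek_int \<alpha> p g) x = ek_int (\<alpha> + \<gamma>) p g x"
proof -
  define K where "K = Gamma p / Gamma (p + (\<alpha> + \<gamma>))"
  have pos: "Gamma p > 0" "Gamma (p + \<alpha>) > 0" "Gamma (p + (\<alpha> + \<gamma>)) > 0"
    using assms by (auto intro!: Gamma_real_pos)
  have "\<bar>ek_int \<gamma> (p + \<alpha>) (ek_int \<alpha> p g) x - ek_int (\<alpha> + \<gamma>) p g x\<bar> \<le> e" if "e > 0" for e
  proof -
    \<comment> \<open>\<open>K\<close> bounds both the composed operator and the single one, since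
      \<open>Gamma (p + \<alpha>)\<close> cancels in the product of the two bounds. Replacing
      \<open>g\<close> by a polynomial therefore costs \<open>d * K\<close> on each side,
      \<open>e\<close> in total.\<close>
    define d where "d = e / (2 * K)"
    have K: "K > 0" using pos by (simp add: K_def)
    have "d > 0" using that K by (simp add: d_def)
    then obtain P where P: "real_polynomial_function P" "\<And>s. s \<in> {0..B} \<Longrightarrow> \<bar>g s - P s\<bar> < d"
      using Stone_Weierstrass_real_polynomial_function[of "{0..B}" g d] assms(4) by auto
    obtain c n where c: "P = (\<lambda>s. \<Sum>i\<le>n. c i * s ^ i)"
      using P(1) unfolding real_polynomial_function_iff_sum by auto
    have contP: "continuous_on {0..B} P" unfolding c by (intro continuous_intros)
    have eqP: "ek_int \<gamma> (p + \<alpha>) (ek_int \<alpha> p P) x = ek_int (\<alpha> + \<gamma>) p P x"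
    proof -
      have "ek_int \<gamma> (p + \<alpha>) (ek_int \<alpha> p P) x
          = ek_int \<gamma> (p + \<alpha>) (\<lambda>s. \<Sum>i\<le>n. (c i * (Gamma (p + i) / Gamma (p + i + \<alpha>))) * s ^ i) x"
        using assms unfolding c by (intro ek_int_cong ek_int_poly) auto
      also have "\<dots> = (\<Sum>i\<le>n. (c i * (Gamma (p + i) / Gamma (p + i + \<alpha>))
          * (Gamma (p + \<alpha> + i) / Gamma (p + \<alpha> + i + \<gamma>))) * x ^ i)"
        using assms by (subst ek_int_poly) auto
      also have "\<dots> = (\<Sum>i\<le>n. (c i * (Gamma (p + i) / Gamma (p + i + (\<alpha> + \<gamma>)))) * x ^ i)"
      proof (rule sum.cong)
        fix i :: nat
        have "Gamma (p + i + \<alpha>) > 0" using assms by (intro Gamma_real_pos) auto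
        then show "(c i * (Gamma (p + i) / Gamma (p + i + \<alpha>))
          * (Gamma (p + \<alpha> + i) / Gamma (p + \<alpha> + i + \<gamma>))) * x ^ i
          = (c i * (Gamma (p + i) / Gamma (p + i + (\<alpha> + \<gamma>)))) * x ^ i"
          by (simp add: add_ac)
      qed simp
      also have "\<dots> = ek_int (\<alpha> + \<gamma>) p P x"
        using assms unfolding c by (subst ek_int_poly) auto
      finally show ?thesis .
    qed
    have 1: "\<bar>ek_int \<alpha> p g s - ek_int \<alpha> p P s\<bar> \<le> d * (Gamma p / Gamma (p + \<alpha>))"
      if "0 \<le> s" "s \<le> B" for s
      using assms P(2) contP that by (intro ek_int_uniform_bound[of _ _ B]) (auto intro: less_imp_le)
    have "\<bar>ek_int \<gamma> (p + \<alpha>) (ek_int \<alpha> p g) x - ek_int \<gamma> (p + \<alpha>) (ek_int \<alpha> p P) x\<bar>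
       \<le> d * (Gamma p / Gamma (p + \<alpha>)) * (Gamma (p + \<alpha>) / Gamma (p + \<alpha> + \<gamma>))"
      by (rule ek_int_uniform_bound[of _ _ B])
        (use assms contP 1 in \<open>auto intro!: continuous_on_ek_int\<close>)
    also have "\<dots> = d * K" using pos by (simp add: K_def add_ac)
    finally have 2: "\<bar>ek_int \<gamma> (p + \<alpha>) (ek_int \<alpha> p g) x - ek_int \<gamma> (p + \<alpha>) (ek_int \<alpha> p P) x\<bar> \<le> d * K" .
    have 3: "\<bar>ek_int (\<alpha> + \<gamma>) p g x - ek_int (\<alpha> + \<gamma>) p P x\<bar> \<le> d * K"
      unfolding K_def
      using assms P(2) contP by (intro ek_int_uniform_bound[of _ _ B]) (auto intro: less_imp_le)
    have "d * K = e / 2" using K by (simp add: d_def)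
    then show ?thesis using 2 3 eqP by linarith
  qed
  then show ?thesis using field_le_epsilon[of "\<bar>ek_int \<gamma> (p + \<alpha>) (ek_int \<alpha> p g) x - ek_int (\<alpha> + \<gamma>) p g x\<bar>" 0] by simp
qed

text \<open>A power weight in the argument only shifts \<open>p\<close>. This brings weighted
  products back to the shape in which the semigroup law applies.\<close>

lemma ek_int_powr_mult:
  assumes "0 \<le> x"
  shows "ek_int \<alpha> p (\<lambda>s. s powr q * g s) x = x powr q * ek_int \<alpha> (p + q) g x"
proof (cases "\<alpha> = 0")
  case False
  have "(1 - u) powr (\<alpha> - 1) * u powr (p - 1) * ((x * u) powr q * g (x * u))
      = x powr q * ((1 - u) powr (\<alpha> - 1) * u powr (p + q - 1) * g (x * u))"
    if "u \<in> {0..1}" for u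
    using that assms powr_add[of u "p - 1" q] by (simp add: powr_mult algebra_simps)
  then have "integral {0..1} (\<lambda>u. (1 - u) powr (\<alpha> - 1) * u powr (p - 1) * ((x * u) powr q * g (x * u)))
     = integral {0..1} (\<lambda>u. x powr q * ((1 - u) powr (\<alpha> - 1) * u powr (p + q - 1) * g (x * u)))"
    by (rule integral_cong)
  then show ?thesis using False by (simp add: ek_int_def)
qed (simp add: ek_int_def)

section \<open>Substitution in the fractional integral with respect to \<Psi>\<close>

lemma strict_mono_on_Icc_deriv_pos:
  fixes \<Psi> :: "real \<Rightarrow> real"
  assumes "\<And>t. t \<in> {a..b} \<Longrightarrow> (\<Psi> has_real_derivative \<Psi>' t) (at t within {a..b})"
    and "\<And>t. t \<in> {a..b} \<Longrightarrow> 0 < \<Psi>' t"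
  shows "strict_mono_on {a..b} \<Psi>"
proof (rule strict_mono_onI)
  fix r s assume rs: "r \<in> {a..b}" "s \<in> {a..b}" "r < s"
  show "\<Psi> r < \<Psi> s"
  proof (rule DERIV_pos_imp_increasing_open[OF rs(3)])
    fix x assume x: "r < x" "x < s"
    have "(\<Psi> has_real_derivative \<Psi>' x) (at x)"
      using assms(1)[of x] rs x at_within_Icc_at[of a x b] by auto
    then show "\<exists>y. (\<Psi> has_real_derivative y) (at x) \<and> 0 < y"
      using assms(2)[of x] rs x by auto
  next
    have "continuous_on {a..b} \<Psi>"
      using assms(1) DERIV_continuous_on by blast
    then show "continuous_on {r..s} \<Psi>"
      by (rule continuous_on_subset) (use rs in auto)
  qed
qed

text \<open>Substitute \<open>u = (\<Psi> s - \<Psi> a) / (\<Psi> t - \<Psi> a)\<close>, an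
  increasing bijection of \<open>{a..t}\<close> onto \<open>{0..1}\<close>. Since \<open>h\<close>
  is prescribed for \<open>s > a\<close> only, the integrands are compared off the negligible set
  \<open>{a}\<close>.\<close>

lemma fractional_kernel_substitution:
  fixes \<Psi> \<Psi>' g h :: "real \<Rightarrow> real"
  assumes at: "a < t"
    and deriv: "\<And>s. s \<in> {a..t} \<Longrightarrow> (\<Psi> has_real_derivative \<Psi>' s) (at s within {a..t})"
    and pos: "\<And>s. s \<in> {a..t} \<Longrightarrow> 0 < \<Psi>' s"
    and \<alpha>: "0 < \<alpha>" and p: "0 < p"
    and g: "continuous_on {0..\<Psi> t - \<Psi> a} g"
    and h: "\<And>s. s \<in> {a<..t} \<Longrightarrow> h s = (\<Psi> s - \<Psi> a) powr (p - 1) * g (\<Psi> s - \<Psi> a)"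
  shows "(\<lambda>s. \<Psi>' s * (\<Psi> t - \<Psi> s) powr (\<alpha> - 1) * h s) absolutely_integrable_on {a..t}" (is ?A)
    and "integral {a..t} (\<lambda>s. \<Psi>' s * (\<Psi> t - \<Psi> s) powr (\<alpha> - 1) * h s)
       = Gamma \<alpha> * ((\<Psi> t - \<Psi> a) powr (\<alpha> + p - 1) * ek_int \<alpha> p g (\<Psi> t - \<Psi> a))" (is ?B)
proof -
  define X where "X = \<Psi> t - \<Psi> a"
  define \<phi> where "\<phi> s = (\<Psi> s - \<Psi> a) / X" for s
  define F where "F u = (1 - u) powr (\<alpha> - 1) * u powr (p - 1) * g (X * u)" for u
  have sm: "strict_mono_on {a..t} \<Psi>" by (rule strict_mono_on_Icc_deriv_pos[OF deriv pos])
  have X: "X > 0" using strict_mono_onD[OF sm, of a t] at by (simp add: X_def)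
  have contPsi: "continuous_on {a..t} \<Psi>" using deriv DERIV_continuous_on by blast
  have contphi: "continuous_on {a..t} \<phi>" unfolding \<phi>_def using X by (intro continuous_intros contPsi) auto
  have img: "\<phi> ` {a..t} = {0..1}"
  proof -
    have "\<phi> ` {a..t} \<subseteq> {0..1}"
      using strict_mono_on_leD[OF sm] at X unfolding \<phi>_def by (auto simp: divide_simps X_def)
    moreover have "u \<in> \<phi> ` {a..t}" if "u \<in> {0..1}" for u
      using IVT'[of \<phi> a u t] that at X contphi by (auto simp: \<phi>_def X_def)
    ultimately show ?thesis by blast
  qed
  have Fi: "F absolutely_integrable_on {0..1}"
    unfolding F_def using beta_kernel_mult_absolutely_integrable[OF \<alpha> p]
      continuous_on_scaled_arg[OF g, of X] X by (simp add: X_def)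
  have key: "(\<lambda>s. \<bar>\<Psi>' s / X\<bar> * F (\<phi> s)) absolutely_integrable_on {a..t} \<and>
     integral {a..t} (\<lambda>s. \<bar>\<Psi>' s / X\<bar> * F (\<phi> s)) = integral {0..1} F"
  proof -
    have 1: "(\<phi> has_field_derivative \<Psi>' s / X) (at s within {a..t})" if "s \<in> {a..t}" for s
      unfolding \<phi>_def using deriv[OF that] X by (auto intro!: derivative_eq_intros)
    have 2: "inj_on \<phi> {a..t}"
      unfolding \<phi>_def inj_on_def using strict_mono_on_imp_inj_on[OF sm] X by (auto simp: inj_on_def)
    show ?thesis
      using has_absolute_integral_change_of_variables_1'[of "{a..t}" \<phi> "\<lambda>s. \<Psi>' s / X" F, OF _ 1 2] Fi img
      by auto
  qed
  have eq: "X powr (\<alpha> + p - 1) * (\<bar>\<Psi>' s / X\<bar> * F (\<phi> s)) = \<Psi>' s * (\<Psi> t - \<Psi> s) powr (\<alpha> - 1) * h s"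
    if "s \<in> {a..t} - {a}" for s
  proof -
    have s: "s \<in> {a..t}" "s \<in> {a<..t}" using that by auto
    have le: "\<Psi> a < \<Psi> s" "\<Psi> s \<le> \<Psi> t"
      using strict_mono_onD[OF sm, of a s] strict_mono_on_leD[OF sm, of s t] s by auto
    have e1: "1 - \<phi> s = (\<Psi> t - \<Psi> s) / X" using X by (simp add: \<phi>_def X_def field_simps)
    have e2: "X * \<phi> s = \<Psi> s - \<Psi> a" using X by (simp add: \<phi>_def)
    have e3: "\<bar>\<Psi>' s / X\<bar> = \<Psi>' s / X" using pos[OF s(1)] X by simp
    \<comment> \<open>The two kernel factors contribute \<open>X powr (\<alpha> - 1)\<close> and
      \<open>X powr (p - 1)\<close>, the Jacobian \<open>\<Psi>' s / X\<close> one more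
      \<open>X\<close>.\<close>
    have "X powr (\<alpha> + p - 1) = X powr ((\<alpha> - 1) + (p - 1) + 1)" by (simp add: algebra_simps)
    then have e4: "X powr (\<alpha> + p - 1) = X powr (\<alpha> - 1) * X powr (p - 1) * X"
      using X by (simp only: powr_add powr_one)
    have "F (\<phi> s) = ((\<Psi> t - \<Psi> s) powr (\<alpha> - 1) / X powr (\<alpha> - 1))
       * ((\<Psi> s - \<Psi> a) powr (p - 1) / X powr (p - 1)) * g (\<Psi> s - \<Psi> a)"
      unfolding F_def e1 e2 using le X by (simp add: powr_divide \<phi>_def)
    then show ?thesis unfolding e3 e4 h[OF s(2)] using X by (simp add: field_simps)
  qed
  have 1: "(\<lambda>s. X powr (\<alpha> + p - 1) * (\<bar>\<Psi>' s / X\<bar> * F (\<phi> s))) absolutely_integrable_on {a..t}"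
    using absolutely_integrable_scaleR_left[OF key[THEN conjunct1], of "X powr (\<alpha> + p - 1)"] by simp
  show ?A
    by (rule absolutely_integrable_spike[OF 1, of "{a}"]) (use eq in auto)
  have "integral {a..t} (\<lambda>s. \<Psi>' s * (\<Psi> t - \<Psi> s) powr (\<alpha> - 1) * h s)
      = integral {a..t} (\<lambda>s. X powr (\<alpha> + p - 1) * (\<bar>\<Psi>' s / X\<bar> * F (\<phi> s)))"
    by (rule integral_spike[of "{a}"]) (use eq in auto)
  also have "\<dots> = X powr (\<alpha> + p - 1) * integral {0..1} F"
    using key by (simp only: integral_mult_right)
  also have "integral {0..1} F = Gamma \<alpha> * ek_int \<alpha> p g X"
    using \<alpha> less_imp_neq[OF Gamma_real_pos[OF \<alpha>]] by (simp add: ek_int_def F_def[abs_def])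
  finally show ?B by (simp add: X_def)
qed

lemma frac_int_eq_ek_int:
  fixes \<Psi> \<Psi>' g h :: "real \<Rightarrow> real"
  assumes "a < t"
    and "\<And>s. s \<in> {a..t} \<Longrightarrow> (\<Psi> has_real_derivative \<Psi>' s) (at s within {a..t})"
    and "\<And>s. s \<in> {a..t} \<Longrightarrow> 0 < \<Psi>' s"
    and "0 \<le> \<alpha>" "0 < p"
    and "continuous_on {0..\<Psi> t - \<Psi> a} g"
    and "\<And>s. s \<in> {a<..t} \<Longrightarrow> h s = (\<Psi> s - \<Psi> a) powr (p - 1) * g (\<Psi> s - \<Psi> a)"
  shows "frac_int \<alpha> \<Psi> \<Psi>' a h t = (\<Psi> t - \<Psi> a) powr (\<alpha> + p - 1) * ek_int \<alpha> p g (\<Psi> t - \<Psi> a)"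
proof (cases "\<alpha> = 0")
  case True
  then show ?thesis using assms by (simp add: frac_int_def ek_int_def)
next
  case False
  then have \<alpha>: "0 < \<alpha>" using assms by simp
  show ?thesis
    using fractional_kernel_substitution(2)[OF assms(1-3) \<alpha> assms(5-7)]
      less_imp_neq[OF Gamma_real_pos[OF \<alpha>]] False
    by (simp add: frac_int_def)
qed

lemma ek_int_eq_integral:
  fixes g h :: "real \<Rightarrow> real"
  assumes "0 < x" "0 < \<alpha>" "0 < p" "continuous_on {0..x} g"
    and "\<And>s. 0 < s \<Longrightarrow> s \<le> x \<Longrightarrow> h s = s powr (p - 1) * g s"
  shows "(\<lambda>s. (x - s) powr (\<alpha> - 1) * h s) absolutely_integrable_on {0..x}"
    and "integral {0..x} (\<lambda>s. (x - s) powr (\<alpha> - 1) * h s)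
       = Gamma \<alpha> * (x powr (\<alpha> + p - 1) * ek_int \<alpha> p g x)"
  using fractional_kernel_substitution[of 0 x "\<lambda>s. s" "\<lambda>s. 1" \<alpha> p g h] assms
  by auto


section \<open>One-sided derivatives and the Mittag-Leffler series\<close>

text \<open>The points where \<open>w\<close> is at most \<open>w s\<close> form a compact set. Its
  last point is \<open>t\<close>: from an earlier one, \<open>step\<close> leads to a later point of
  the same set.\<close>

lemma le_of_right_nonincreasing:
  fixes w :: "real \<Rightarrow> real"
  assumes "s \<le> t" "continuous_on {s..t} w"
    and step: "\<And>q. s \<le> q \<Longrightarrow> q < t \<Longrightarrow> \<exists>r. q < r \<and> r \<le> t \<and> w r \<le> w q"
  shows "w t \<le> w s"
proof -
  define A where "A = {s..t} \<inter> w -` {..w s}"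
  have "closed A" unfolding A_def using assms(2) by (intro continuous_closed_preimage) auto
  then have "compact A" unfolding A_def by (metis compact_Icc compact_Int_closed inf_left_idem)
  moreover have "s \<in> A" using assms(1) by (simp add: A_def)
  ultimately obtain q where q: "q \<in> A" "\<And>r. r \<in> A \<Longrightarrow> r \<le> q"
    using compact_attains_sup[of A] by blast
  have "q = t"
  proof (rule ccontr)
    assume "q \<noteq> t"
    then have qt: "s \<le> q" "q < t" using q(1) by (auto simp: A_def)
    then obtain r where "q < r" "r \<le> t" "w r \<le> w q" using step by blast
    then have "r \<in> A" using q(1) by (auto simp: A_def)
    then show False using q(2) \<open>q < r\<close> by fastforce
  qed
  then show ?thesis using q(1) by (simp add: A_def)
qed

text \<open>For every \<open>M > \<epsilon>\<close> the function \<open>E s - M * s\<close>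
  satisfies the step condition of \<open>le_of_right_nonincreasing\<close>; this is applied to
  \<open>D\<close> and to \<open>- D\<close>, and then \<open>M\<close> tends to
  \<open>\<epsilon>\<close>. One sequence of right-hand quotients per point suffices because the
  step condition asks for a single later point.\<close>

lemma Lipschitz_of_right_derivative_bound:
  fixes D :: "real \<Rightarrow> real"
  assumes cont: "continuous_on {0..B} D"
    and der: "\<And>x. 0 < x \<Longrightarrow> x < B \<Longrightarrow>
      \<exists>r d. (\<forall>n. x < r n) \<and> r \<longlonglongrightarrow> x \<and> (\<lambda>n. (D (r n) - D x) / (r n - x)) \<longlonglongrightarrow> d \<and> \<bar>d\<bar> \<le> \<epsilon>"
    and xy: "0 \<le> x" "x \<le> y" "y \<le> B"
  shows "\<bar>D y - D x\<bar> \<le> \<epsilon> * (y - x)"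
proof -
  have upper: "E y - E x \<le> M * (y - x)"
    if E: "continuous_on {0..B} E" and M: "\<epsilon> < M" and xy: "0 < x" "x \<le> y" "y \<le> B"
     and derE: "\<And>x. 0 < x \<Longrightarrow> x < B \<Longrightarrow>
      \<exists>r d. (\<forall>n. x < r n) \<and> r \<longlonglongrightarrow> x \<and> (\<lambda>n. (E (r n) - E x) / (r n - x)) \<longlonglongrightarrow> d \<and> \<bar>d\<bar> \<le> \<epsilon>"
   for E M x y
  proof -
    have "E y - M * y \<le> E x - M * x"
    proof (rule le_of_right_nonincreasing[of x y "\<lambda>s. E s - M * s"])
      show "continuous_on {x..y} (\<lambda>s. E s - M * s)"
        using xy by (intro continuous_intros continuous_on_subset[OF E]) auto
      fix q assume q: "x \<le> q" "q < y"
      obtain r d where r: "\<forall>n. q < r n" "r \<longlonglongrightarrow> q" "(\<lambda>n. (E (r n) - E q) / (r n - q)) \<longlonglongrightarrow> d" "\<bar>d\<bar> \<le> \<epsilon>"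
        using derE[of q] q xy by force
      have "\<forall>\<^sub>F n in sequentially. r n < y" using order_tendstoD(2)[OF r(2) q(2)] .
      moreover have "\<forall>\<^sub>F n in sequentially. (E (r n) - E q) / (r n - q) < M"
        using order_tendstoD(2)[OF r(3), of M] r(4) M by auto
      ultimately have "\<forall>\<^sub>F n in sequentially. r n < y \<and> (E (r n) - E q) / (r n - q) < M"
        by (rule eventually_conj)
      then obtain n where n: "r n < y" "(E (r n) - E q) / (r n - q) < M"
        using eventually_happens by fastforce
      have "E (r n) - E q \<le> M * (r n - q)"
        using n(2) r(1) by (simp add: pos_divide_less_eq less_imp_le)
      then have "E (r n) - M * r n \<le> E q - M * q" by (simp add: algebra_simps)
      then show "\<exists>r. q < r \<and> r \<le> y \<and> E r - M * r \<le> E q - M * q"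
        using n(1) r(1) by (meson less_imp_le)
    qed (use xy in auto)
    then show ?thesis by (simp add: algebra_simps)
  qed
  have pos: "\<bar>D y - D x\<bar> \<le> \<epsilon> * (y - x)" if xy: "0 < x" "x \<le> y" "y \<le> B" for x y
  proof -
    have derm: "\<exists>r d. (\<forall>n. z < r n) \<and> r \<longlonglongrightarrow> z \<and> (\<lambda>n. (- D (r n) - - D z) / (r n - z)) \<longlonglongrightarrow> d \<and> \<bar>d\<bar> \<le> \<epsilon>"
      if z: "0 < z" "z < B" for z
    proof -
      obtain r d where r: "\<forall>n. z < r n" "r \<longlonglongrightarrow> z" "(\<lambda>n. (D (r n) - D z) / (r n - z)) \<longlonglongrightarrow> d" "\<bar>d\<bar> \<le> \<epsilon>"
        using der[OF z] by blast
      have "(\<lambda>n. (- D (r n) - - D z) / (r n - z)) = (\<lambda>n. - ((D (r n) - D z) / (r n - z)))"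
        by (auto simp: minus_divide_left)
      then have "(\<lambda>n. (- D (r n) - - D z) / (r n - z)) \<longlonglongrightarrow> - d"
        using tendsto_minus[OF r(3)] by simp
      then show ?thesis using r by (intro exI[of _ r] exI[of _ "- d"]) auto
    qed
    have "\<bar>D y - D x\<bar> \<le> \<epsilon> * (y - x) + e" if e: "0 < e" for e
    proof -
      \<comment> \<open>The slack \<open>(M - \<epsilon>) * (y - x)\<close> stays below
        \<open>e\<close>; the 1 in the denominator keeps it nonzero when
        \<open>y = x\<close>.\<close>
      define M where "M = \<epsilon> + e / (y - x + 1)"
      have M: "\<epsilon> < M" using e xy by (simp add: M_def)
      have "D y - D x \<le> M * (y - x)" by (rule upper[OF cont M xy der])
      moreover have "- D y - - D x \<le> M * (y - x)"
        by (rule upper[OF _ M xy derm]) (use cont in \<open>auto intro: continuous_intros\<close>)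
      moreover have "M * (y - x) \<le> \<epsilon> * (y - x) + e"
        using e xy by (simp add: M_def field_simps)
      ultimately show ?thesis by linarith
    qed
    then show ?thesis by (rule field_le_epsilon)
  qed
  show ?thesis
  proof (cases "x = 0 \<and> y > 0")
    case True
    \<comment> \<open>Nothing is assumed about quotients at 0, so the estimate between
      \<open>y / Suc n\<close> and \<open>y\<close> is carried to the limit by continuity of
      \<open>D\<close>.\<close>
    have "(\<lambda>n. y / real (Suc n)) \<longlonglongrightarrow> 0" using tendsto_mult_right_zero[OF LIMSEQ_inverse_real_of_nat, of y] by (simp add: divide_inverse)
    moreover have "\<And>n. y / real (Suc n) \<in> {0..B}" "\<And>n. 0 < y / real (Suc n)" "\<And>n. y / real (Suc n) \<le> y"
    proof -
      fix n
      show "y / real (Suc n) \<le> y" using True by (simp add: field_simps)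
      then show "y / real (Suc n) \<in> {0..B}" "0 < y / real (Suc n)" using True xy by auto
    qed
    ultimately have lim: "(\<lambda>n. D (y / real (Suc n))) \<longlonglongrightarrow> D 0"
      using continuous_on_tendsto_compose[OF cont, of "\<lambda>n. y / real (Suc n)" 0] True xy by auto
    have "(\<lambda>n. \<bar>D y - D (y / real (Suc n))\<bar>) \<longlonglongrightarrow> \<bar>D y - D 0\<bar>"
      by (intro tendsto_intros lim)
    moreover have "(\<lambda>n. \<epsilon> * (y - y / real (Suc n))) \<longlonglongrightarrow> \<epsilon> * (y - 0)"
      by (intro tendsto_intros) fact
    moreover have "\<bar>D y - D (y / real (Suc n))\<bar> \<le> \<epsilon> * (y - y / real (Suc n))" for n
      using pos[of "y / real (Suc n)" y] True xy \<open>\<And>n. 0 < y / real (Suc n)\<close> \<open>\<And>n. y / real (Suc n) \<le> y\<close> by blast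
    ultimately have "\<bar>D y - D 0\<bar> \<le> \<epsilon> * (y - 0)" by (intro LIMSEQ_le) auto
    then show ?thesis using True by simp
  next
    case False
    then show ?thesis using pos[of x y] xy by (cases "x = 0") auto
  qed
qed

section \<open>Growth of the Gamma function and convergence of the Mittag-Leffler series\<close>

lemma Gamma_ge_powr:
  fixes A x :: real
  assumes "0 < A" "0 \<le> x"
  shows "A powr x * exp (- A) \<le> Gamma (x + 1)"
proof -
  have G: "((\<lambda>t. t powr (x + 1 - 1) / exp t) has_integral Gamma (x + 1)) {0..}"
    using assms by (intro Gamma_integral_real) auto
  \<comment> \<open>On the tail \<open>t \<ge> A\<close> the factor \<open>t powr x\<close> of
    Euler's integral is at least \<open>A powr x\<close>, and \<open>exp (- t)\<close> integrates to
    \<open>exp (- A)\<close>. As \<open>A\<close> is free, Gamma outgrows every geometric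
    sequence.\<close>
  have E: "((\<lambda>t. A powr x * exp (- 1 * t)) has_integral A powr x * (exp (- 1 * A) / 1)) {A..}"
    by (intro has_integral_mult_right has_integral_exp_minus_to_infinity) auto
  have "((\<lambda>t. if t \<in> {A..} then A powr x * exp (- 1 * t) else 0) has_integral A powr x * (exp (- 1 * A) / 1)) {0..}"
    using E assms by (subst has_integral_restrict) auto
  then have "A powr x * (exp (- 1 * A) / 1) \<le> Gamma (x + 1)"
    by (rule has_integral_le[OF _ G])
      (use assms in \<open>auto simp: exp_minus field_simps intro!: powr_mono2\<close>)
  then show ?thesis by simp
qed

lemma summable_mittag_leffler:
  fixes \<mu> z :: real
  assumes "0 < \<mu>" "0 \<le> z"
  shows "summable (\<lambda>k. z ^ k / Gamma (real k * \<mu> + 1))"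
proof -
  \<comment> \<open>This choice makes \<open>A powr (k * \<mu>)\<close> equal to
    \<open>(2 * z + 1) ^ k\<close>, and \<open>z / (2 * z + 1) \<le> 1 / 2\<close> yields a
    geometric majorant. The summand 1 keeps \<open>A\<close> positive at
    \<open>z = 0\<close>.\<close>
  define A where "A = (2 * z + 1) powr (1 / \<mu>)"
  have A: "0 < A" using assms by (simp add: A_def)
  have Ak: "A powr (real k * \<mu>) = (2 * z + 1) ^ k" for k
    using assms by (simp add: A_def powr_powr powr_realpow)
  have le: "norm (z ^ k / Gamma (real k * \<mu> + 1)) \<le> exp A * (1 / 2) ^ k" for k
  proof -
    have G: "(2 * z + 1) ^ k * exp (- A) \<le> Gamma (real k * \<mu> + 1)"
      using Gamma_ge_powr[OF A, of "real k * \<mu>"] assms Ak[of k] by simp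
    have P: "0 < (2 * z + 1) ^ k * exp (- A)" using assms by simp
    have "z ^ k / Gamma (real k * \<mu> + 1) \<le> z ^ k / ((2 * z + 1) ^ k * exp (- A))"
      using G P assms less_le_trans[OF P G] by (intro divide_left_mono mult_pos_pos) auto
    also have "\<dots> = exp A * (z / (2 * z + 1)) ^ k"
      by (simp add: exp_minus power_divide field_simps)
    also have "\<dots> \<le> exp A * (1 / 2) ^ k"
      using assms by (intro mult_left_mono power_mono) (auto simp: field_simps)
    finally show ?thesis
      using less_le_trans[OF P G] assms by simp
  qed
  have sm: "summable (\<lambda>k. exp A * (1 / 2 :: real) ^ k)"
    by (intro summable_mult summable_geometric) simp
  show ?thesis
    by (rule summable_comparison_test'[OF sm le])
qed


section \<open>Right-hand derivative of a fractional integral\<close>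

lemma Gamma_one_plus:
  fixes x :: real
  assumes "0 < x"
  shows "Gamma (1 + x) = x * Gamma x"
proof -
  have "x \<notin> \<int>\<^sub>\<le>\<^sub>0" using assms nonpos_Ints_nonpos[of x] by force
  then show ?thesis using Gamma_plus1[of x] by (simp add: add.commute)
qed

lemma powr_kernel_absolutely_integrable:
  fixes x \<beta> :: real
  assumes "a < x" "0 < \<beta>"
  shows "(\<lambda>s. (x - s) powr (\<beta> - 1)) absolutely_integrable_on {a..x}"
    and "integral {a..x} (\<lambda>s. (x - s) powr (\<beta> - 1)) = (x - a) powr \<beta> / \<beta>"
proof -
  have G: "Gamma \<beta> > 0" "Gamma (1 + \<beta>) = \<beta> * Gamma \<beta>"
    using assms by (auto intro: Gamma_real_pos Gamma_one_plus)
  have "ek_int \<beta> 1 (\<lambda>s. 1) (x - a) = 1 / Gamma (1 + \<beta>)"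
    using ek_int_const[of \<beta> 1 1 "x - a"] assms by simp
  then show "(\<lambda>s. (x - s) powr (\<beta> - 1)) absolutely_integrable_on {a..x}"
    and "integral {a..x} (\<lambda>s. (x - s) powr (\<beta> - 1)) = (x - a) powr \<beta> / \<beta>"
    using fractional_kernel_substitution[of a x "\<lambda>s. s" "\<lambda>s. 1" \<beta> 1 "\<lambda>s. 1" "\<lambda>s. 1"] assms G
    by (auto simp: field_simps)
qed

text \<open>For \<open>\<beta> \<le> 1\<close> the exponent \<open>\<beta> - 2\<close> alone is too
  singular; the Lipschitz condition at \<open>x\<close> absorbs one factor \<open>x - s\<close>,
  leaving a bounded measurable function times the integrable kernel with exponent
  \<open>\<beta> - 1\<close>.\<close>

lemma marchaud_kernel_absolutely_integrable:
  fixes \<Phi> :: "real \<Rightarrow> real"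
  assumes "0 < x" "0 < \<beta>" "continuous_on {0..x} \<Phi>"
    and Lip: "\<And>y. y \<in> {0..x} \<Longrightarrow> \<bar>\<Phi> y - \<Phi> x\<bar> \<le> C * \<bar>y - x\<bar>"
  shows "(\<lambda>s. (x - s) powr (\<beta> - 2) * (\<Phi> s - \<Phi> x)) absolutely_integrable_on {0..x}"
proof -
  have int: "(\<lambda>s. ((\<Phi> s - \<Phi> x) / (x - s)) * (x - s) powr (\<beta> - 1)) absolutely_integrable_on {0..x}"
  proof (rule absolutely_integrable_bounded_measurable_product_real)
    have "(\<lambda>s. \<Phi> s - \<Phi> x) \<in> borel_measurable (lebesgue_on {0..x})"
      "(\<lambda>s. x - s) \<in> borel_measurable (lebesgue_on {0..x})"
      using assms(3) by (auto intro!: continuous_imp_measurable_on_sets_lebesgue continuous_intros)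
    then show "(\<lambda>s. (\<Phi> s - \<Phi> x) / (x - s)) \<in> borel_measurable (lebesgue_on {0..x})"
      by (rule borel_measurable_divide)
    have "\<bar>(\<Phi> s - \<Phi> x) / (x - s)\<bar> \<le> \<bar>C\<bar>" if s: "s \<in> {0..x}" for s
    proof (cases "s = x")
      case False
      have "C * \<bar>s - x\<bar> \<le> \<bar>C\<bar> * \<bar>s - x\<bar>" by (intro mult_right_mono) auto
      then have "\<bar>\<Phi> s - \<Phi> x\<bar> \<le> \<bar>C\<bar> * \<bar>x - s\<bar>"
        using Lip[OF s] abs_minus_commute[of x s] by simp
      then show ?thesis using False by (simp add: abs_divide divide_le_eq)
    qed simp
    then show "bounded ((\<lambda>s. (\<Phi> s - \<Phi> x) / (x - s)) ` {0..x})"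
      by (auto simp: bounded_iff intro!: exI[of _ "\<bar>C\<bar>"])
  qed (use powr_kernel_absolutely_integrable[of 0 x \<beta>] assms in auto)
  have eq: "((\<Phi> s - \<Phi> x) / (x - s)) * (x - s) powr (\<beta> - 1) = (x - s) powr (\<beta> - 2) * (\<Phi> s - \<Phi> x)"
    if "s \<in> {0..x}" for s
  proof (cases "s = x")
    case False
    then have "0 < x - s" using that by auto
    then have "(x - s) powr (\<beta> - 1) = (x - s) powr (\<beta> - 2) * (x - s)"
      using powr_add[of "x - s" "\<beta> - 2" 1] by simp
    then show ?thesis using False by simp
  qed simp
  show ?thesis
    by (rule absolutely_integrable_spike[OF int, of "{}"]) (use eq in auto)
qed

text \<open>Increments to the right are used because the difference quotients of the kernel are then dominated
  by its derivative at \<open>x\<close>, which is integrable against \<open>\<Phi> - \<Phi> x\<close>.\<close>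

lemma frac_int_right_derivative:
  fixes \<Phi> :: "real \<Rightarrow> real"
  assumes x: "0 < x" "x < B" and \<beta>: "0 < \<beta>" "\<beta> < 1" and cont: "continuous_on {0..B} \<Phi>"
    and Lip: "\<And>y. y \<in> {0..B} \<Longrightarrow> \<bar>\<Phi> y - \<Phi> x\<bar> \<le> C * \<bar>y - x\<bar>"
    and r: "\<And>n. x < r n" "\<And>n. r n \<le> B" "r \<longlonglongrightarrow> x"
    and K: "\<And>y. 0 < y \<Longrightarrow> y \<le> B \<Longrightarrow> K y = y powr \<beta> * ek_int \<beta> 1 (\<lambda>s. \<Phi> s - c) y"
  shows "(\<lambda>n. (K (r n) - K x) / (r n - x)) \<longlonglongrightarrow>
     (x powr (\<beta> - 1) * (\<Phi> x - c)
       - (1 - \<beta>) * integral {0..x} (\<lambda>s. (x - s) powr (\<beta> - 2) * (\<Phi> s - \<Phi> x))) / Gamma \<beta>"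
proof -
  \<comment> \<open>Subtracting the value at \<open>x\<close> gives a factor that vanishes linearly
    at the singularity; the remaining constant \<open>\<Phi> x - c\<close> contributes an explicit
    multiple of \<open>y powr \<beta>\<close> in \<open>Keq\<close>.\<close>
  define F where "F s = \<Phi> s - \<Phi> x" for s
  define m where "m s = (x - s) powr (\<beta> - 2) * F s" for s
  define f where "f n s = ((r n - s) powr (\<beta> - 1) - (x - s) powr (\<beta> - 1)) / (r n - x) * F s" for n s
  have G: "Gamma \<beta> > 0" "Gamma (1 + \<beta>) = \<beta> * Gamma \<beta>"
    using \<beta> by (auto intro: Gamma_real_pos Gamma_one_plus)
  have contF: "continuous_on {0..y} F" if "y \<le> B" for y
    unfolding F_def using that by (intro continuous_intros continuous_on_subset[OF cont]) auto
  have Lip': "\<bar>F y\<bar> \<le> C * \<bar>y - x\<bar>" if "y \<in> {0..B}" for y using Lip[OF that] by (simp add: F_def)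
  have C: "0 \<le> C" using order_trans[OF abs_ge_zero Lip'[of B]] x by (simp add: zero_le_mult_iff)
  have int_F: "(\<lambda>s. (y - s) powr (\<beta> - 1) * F s) integrable_on {0..y}"
    and eq_F: "integral {0..y} (\<lambda>s. (y - s) powr (\<beta> - 1) * F s) = Gamma \<beta> * (y powr \<beta> * ek_int \<beta> 1 F y)"
    if "0 < y" "y \<le> B" for y
    using ek_int_eq_integral[of y \<beta> 1 F F] that \<beta> contF by (auto intro: set_lebesgue_integral_eq_integral)
  have Keq: "K y = integral {0..y} (\<lambda>s. (y - s) powr (\<beta> - 1) * F s) / Gamma \<beta>
      + (\<Phi> x - c) * (y powr \<beta> / Gamma (1 + \<beta>))"
    if y: "0 < y" "y \<le> B" for y
  proof -
    have "ek_int \<beta> 1 (\<lambda>s. \<Phi> s - c) y = ek_int \<beta> 1 (\<lambda>s. F s + (\<Phi> x - c)) y"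
      by (simp add: F_def)
    also have "\<dots> = ek_int \<beta> 1 F y + ek_int \<beta> 1 (\<lambda>s. \<Phi> x - c) y"
      using y \<beta> contF[of B] by (intro ek_int_add[of _ _ B]) auto
    also have "ek_int \<beta> 1 (\<lambda>s. \<Phi> x - c) y = (\<Phi> x - c) / Gamma (1 + \<beta>)"
      using ek_int_const[of \<beta> 1] \<beta> by simp
    finally show ?thesis
      unfolding K[OF y] eq_F[OF y] using G by (simp add: ring_distribs)
  qed
  have int_x: "(\<lambda>s. (y - s) powr (\<beta> - 1) * F s) integrable_on {0..x}" if "x \<le> y" "y \<le> B" for y
    by (rule integrable_subinterval_real[OF int_F[of y]]) (use that x in auto)
  have int_f: "f n integrable_on {0..x}" for n
  proof -
    have "(\<lambda>s. ((r n - s) powr (\<beta> - 1) * F s - (x - s) powr (\<beta> - 1) * F s) / (r n - x)) integrable_on {0..x}"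
      using r(1,2)[of n] x by (intro integrable_on_divide integrable_diff int_x) auto
    then show ?thesis by (simp add: f_def[abs_def] left_diff_distrib diff_divide_distrib)
  qed
  have int_k: "(\<lambda>s. (1 - \<beta>) * C * (x - s) powr (\<beta> - 1)) integrable_on {0..x}"
    using powr_kernel_absolutely_integrable(1)[of 0 x \<beta>] x \<beta>
    by (intro integrable_on_cmult_left[of _ _ "(1 - \<beta>) * C"] set_lebesgue_integral_eq_integral(1)) auto
  have dom: "norm (f n s) \<le> (1 - \<beta>) * C * (x - s) powr (\<beta> - 1)" if s: "s \<in> {0..x}" for n s
  proof (cases "s = x")
    case True then show ?thesis by (simp add: f_def F_def)
  next
    case False
    then have sx: "0 < x - s" using s by auto
    have "\<exists>z. x < z \<and> z < r n \<and> (r n - s) powr (\<beta> - 1) - (x - s) powr (\<beta> - 1)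
        = (r n - x) * ((\<beta> - 1) * (z - s) powr (\<beta> - 1 - 1))"
      using sx by (intro MVT2[OF r(1)[of n]]) (auto intro!: derivative_eq_intros)
    then obtain z where z: "x < z" "(r n - s) powr (\<beta> - 1) - (x - s) powr (\<beta> - 1)
        = (r n - x) * ((\<beta> - 1) * (z - s) powr (\<beta> - 2))" by auto
    have "norm (f n s) = (1 - \<beta>) * (z - s) powr (\<beta> - 2) * \<bar>F s\<bar>"
      unfolding f_def z(2) using r(1)[of n] \<beta> by (simp add: abs_mult)
    also have "\<dots> \<le> (1 - \<beta>) * (x - s) powr (\<beta> - 2) * (C * (x - s))"
      using \<beta> sx z(1) Lip'[of s] s x C
      by (intro mult_mono mult_left_mono powr_mono2') auto
    also have "\<dots> = (1 - \<beta>) * C * ((x - s) powr (\<beta> - 2) * (x - s) powr 1)"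
      using sx by simp
    also have "(x - s) powr (\<beta> - 2) * (x - s) powr 1 = (x - s) powr (\<beta> - 1)"
      unfolding powr_add[symmetric] by simp
    finally show ?thesis .
  qed
  have lim_f: "(\<lambda>n. f n s) \<longlonglongrightarrow> (\<beta> - 1) * m s" if s: "s \<in> {0..x}" for s
  proof (cases "s = x")
    case True then show ?thesis by (simp add: f_def m_def F_def)
  next
    case False
    then have sx: "0 < x - s" using s by auto
    have "((\<lambda>y. (y - s) powr (\<beta> - 1)) has_real_derivative (\<beta> - 1) * (x - s) powr (\<beta> - 2)) (at x)"
      using sx by (auto intro!: derivative_eq_intros)
    then have "((\<lambda>y. ((y - s) powr (\<beta> - 1) - (x - s) powr (\<beta> - 1)) / (y - x)) \<longlongrightarrow> (\<beta> - 1) * (x - s) powr (\<beta> - 2)) (at x)"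
      by (simp add: has_field_derivative_iff)
    moreover have "filterlim r (at x) sequentially"
      unfolding filterlim_at using r(3) less_imp_neq[OF r(1)] by (auto intro!: always_eventually)
    ultimately have "(\<lambda>n. ((r n - s) powr (\<beta> - 1) - (x - s) powr (\<beta> - 1)) / (r n - x)) \<longlonglongrightarrow> (\<beta> - 1) * (x - s) powr (\<beta> - 2)"
      by (rule filterlim_compose)
    from tendsto_mult_right[OF this, of "F s"] show ?thesis
      unfolding f_def m_def by (simp only: mult.assoc)
  qed
  have lim1: "(\<lambda>n. integral {0..x} (f n)) \<longlonglongrightarrow> (\<beta> - 1) * integral {0..x} m"
    using dominated_convergence(2)[OF int_f int_k dom lim_f] by simp
  \<comment> \<open>The contribution of the interval between \<open>x\<close> and
    \<open>r n\<close>, which has no counterpart in the limit: the Lipschitz bound makes it of order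
    \<open>(r n - x) powr \<beta>\<close>.\<close>
  define T where "T n = integral {x..r n} (\<lambda>s. (r n - s) powr (\<beta> - 1) * F s) / (r n - x)" for n
  have T_bound: "norm (T n) \<le> C * ((r n - x) powr \<beta> / \<beta>)" for n
  proof -
    have rx: "0 < r n - x" using r(1) by simp
    have "norm (integral {x..r n} (\<lambda>s. (r n - s) powr (\<beta> - 1) * F s))
        \<le> integral {x..r n} (\<lambda>s. C * (r n - x) * (r n - s) powr (\<beta> - 1))"
    proof (rule integral_norm_bound_integral)
      show "(\<lambda>s. (r n - s) powr (\<beta> - 1) * F s) integrable_on {x..r n}"
        by (rule integrable_subinterval_real[OF int_F[of "r n"]]) (use r(1,2)[of n] x in auto)
      show "(\<lambda>s. C * (r n - x) * (r n - s) powr (\<beta> - 1)) integrable_on {x..r n}"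
        using powr_kernel_absolutely_integrable(1)[of x "r n" \<beta>] r(1)[of n] \<beta>
        by (intro integrable_on_cmult_left[of _ _ "C * (r n - x)"] set_lebesgue_integral_eq_integral(1)) auto
      fix s assume s: "s \<in> {x..r n}"
      have "\<bar>F s\<bar> \<le> C * \<bar>s - x\<bar>" using s r(2)[of n] x by (intro Lip') auto
      also have "\<dots> \<le> C * (r n - x)" using s C by (intro mult_left_mono) auto
      finally show "norm ((r n - s) powr (\<beta> - 1) * F s) \<le> C * (r n - x) * (r n - s) powr (\<beta> - 1)"
        by (simp add: abs_mult mult_right_mono mult.commute)
    qed
    also have "\<dots> = C * (r n - x) * ((r n - x) powr \<beta> / \<beta>)"
      using powr_kernel_absolutely_integrable(2)[of x "r n" \<beta>] r(1)[of n] \<beta> by simp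
    finally show ?thesis using rx unfolding T_def by (simp add: abs_divide divide_le_eq mult_ac)
  qed
  have limT: "T \<longlonglongrightarrow> 0"
  proof (rule Lim_null_comparison)
    show "\<forall>\<^sub>F n in sequentially. norm (T n) \<le> C * ((r n - x) powr \<beta> / \<beta>)" using T_bound by simp
    have "(\<lambda>n. r n - x) \<longlonglongrightarrow> x - x" by (intro tendsto_intros r(3))
    then have "(\<lambda>n. (r n - x) powr \<beta>) \<longlonglongrightarrow> 0"
      using \<beta> by (intro tendsto_zero_powrI[of _ _ _ \<beta>]) (auto intro!: always_eventually less_imp_le r(1))
    then show "(\<lambda>n. C * ((r n - x) powr \<beta> / \<beta>)) \<longlonglongrightarrow> 0"
      by (intro tendsto_mult_right_zero tendsto_divide_zero)
  qed
  have limP: "(\<lambda>n. (r n powr \<beta> - x powr \<beta>) / (r n - x)) \<longlonglongrightarrow> \<beta> * x powr (\<beta> - 1)"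
  proof -
    have "((\<lambda>y. y powr \<beta>) has_real_derivative \<beta> * x powr (\<beta> - 1)) (at x)"
      using x by (auto intro!: derivative_eq_intros)
    then have "((\<lambda>y. (y powr \<beta> - x powr \<beta>) / (y - x)) \<longlongrightarrow> \<beta> * x powr (\<beta> - 1)) (at x)"
      by (simp add: has_field_derivative_iff)
    moreover have "filterlim r (at x) sequentially"
      unfolding filterlim_at using r(3) less_imp_neq[OF r(1)] by (auto intro!: always_eventually)
    ultimately show ?thesis by (rule filterlim_compose)
  qed
  \<comment> \<open>Three parts with separate limits: the kernel quotients over
    \<open>{0..x}\<close> by dominated convergence, the end piece \<open>T\<close>, and the explicit
    power that comes from the constant.\<close>
  have quot: "(K (r n) - K x) / (r n - x) = (integral {0..x} (f n) + T n) / Gamma \<beta>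
      + (\<Phi> x - c) / Gamma (1 + \<beta>) * ((r n powr \<beta> - x powr \<beta>) / (r n - x))" for n
  proof -
    have rx: "0 < r n - x" "0 < r n" "r n \<le> B" using r(1,2)[of n] x by auto
    have "integral {0..x} (f n) = (integral {0..x} (\<lambda>s. (r n - s) powr (\<beta> - 1) * F s)
        - integral {0..x} (\<lambda>s. (x - s) powr (\<beta> - 1) * F s)) / (r n - x)"
    proof -
      have "integral {0..x} (f n) = integral {0..x} (\<lambda>s. ((r n - s) powr (\<beta> - 1) * F s - (x - s) powr (\<beta> - 1) * F s) / (r n - x))"
        by (simp add: f_def[abs_def] left_diff_distrib)
      also have "\<dots> = integral {0..x} (\<lambda>s. ((r n - s) powr (\<beta> - 1) * F s - (x - s) powr (\<beta> - 1) * F s)) / (r n - x)"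
        by simp
      also have "integral {0..x} (\<lambda>s. ((r n - s) powr (\<beta> - 1) * F s - (x - s) powr (\<beta> - 1) * F s))
        = integral {0..x} (\<lambda>s. (r n - s) powr (\<beta> - 1) * F s) - integral {0..x} (\<lambda>s. (x - s) powr (\<beta> - 1) * F s)"
        using rx x by (intro integral_diff int_x) auto
      finally show ?thesis .
    qed
    moreover have "integral {0..r n} (\<lambda>s. (r n - s) powr (\<beta> - 1) * F s)
       = integral {0..x} (\<lambda>s. (r n - s) powr (\<beta> - 1) * F s) + integral {x..r n} (\<lambda>s. (r n - s) powr (\<beta> - 1) * F s)"
      using Henstock_Kurzweil_Integration.integral_combine[of 0 x "r n", OF _ _ int_F] rx x by simp
    moreover have "R - Q = (A + S / h) * h" if "A = (P - Q) / h" "R = P + S" "0 < h" for A P Q R S h :: real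
      using that by (simp add: distrib_right)
    ultimately have e: "integral {0..r n} (\<lambda>s. (r n - s) powr (\<beta> - 1) * F s) - integral {0..x} (\<lambda>s. (x - s) powr (\<beta> - 1) * F s)
       = (integral {0..x} (f n) + T n) * (r n - x)"
      using rx(1) unfolding T_def by blast
    have "k1 - k2 = (R - Q) / g + d / G * (u - v)"
      if "k1 = R / g + d * (u / G)" "k2 = Q / g + d * (v / G)" for k1 k2 R Q g d G u v :: real
      using that by (simp add: diff_divide_distrib right_diff_distrib)
    then have "K (r n) - K x = (integral {0..r n} (\<lambda>s. (r n - s) powr (\<beta> - 1) * F s) - integral {0..x} (\<lambda>s. (x - s) powr (\<beta> - 1) * F s)) / Gamma \<beta>
       + (\<Phi> x - c) / Gamma (1 + \<beta>) * (r n powr \<beta> - x powr \<beta>)"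
      using Keq[OF rx(2,3)] Keq[OF x(1) less_imp_le[OF x(2)]] by blast
    also have "\<dots> = ((integral {0..x} (f n) + T n) / Gamma \<beta>) * (r n - x)
       + (\<Phi> x - c) / Gamma (1 + \<beta>) * (r n powr \<beta> - x powr \<beta>)"
      unfolding e by simp
    finally show ?thesis using rx by (simp add: add_divide_distrib)
  qed
  have "(\<lambda>n. (K (r n) - K x) / (r n - x)) \<longlonglongrightarrow> ((\<beta> - 1) * integral {0..x} m + 0) / Gamma \<beta>
      + (\<Phi> x - c) / Gamma (1 + \<beta>) * (\<beta> * x powr (\<beta> - 1))"
    unfolding quot using G by (intro tendsto_intros lim1 limT limP) auto
  moreover have "((\<beta> - 1) * integral {0..x} m + 0) / Gamma \<beta>
      + (\<Phi> x - c) / Gamma (1 + \<beta>) * (\<beta> * x powr (\<beta> - 1))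
    = (x powr (\<beta> - 1) * (\<Phi> x - c) - (1 - \<beta>) * integral {0..x} m) / Gamma \<beta>"
  proof -
    have "((\<beta> - 1) * I + 0) / g + d / (\<beta> * g) * (\<beta> * p) = (p * d - (1 - \<beta>) * I) / g"
      if "g \<noteq> 0" for I g d p :: real
      using that \<beta> by (simp add: field_simps)
    then show ?thesis using G by simp
  qed
  ultimately show ?thesis unfolding m_def F_def by simp
qed


section \<open>The change of variable \<open>x = \<Psi> t - \<Psi> a\<close>\<close>

text \<open>The standing assumptions in the form that makes \<open>\<Psi> t - \<Psi> a\<close> a
  strictly increasing change of variable. Positivity of \<open>\<Psi>'\<close> is obtained from
  monotonicity and nonvanishing in \<open>deriv_pos_of_mono\<close>.\<close>

locale psi_scale =
  fixes a b :: real and \<Psi> \<Psi>' :: "real \<Rightarrow> real"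
  assumes ab: "a < b"
    and deriv: "\<And>t. t \<in> {a..b} \<Longrightarrow> (\<Psi> has_real_derivative \<Psi>' t) (at t within {a..b})"
    and deriv_pos: "\<And>t. t \<in> {a..b} \<Longrightarrow> 0 < \<Psi>' t"
begin

definition X :: "real \<Rightarrow> real" where "X t = \<Psi> t - \<Psi> a"

lemma X_a [simp]: "X a = 0"
  by (simp add: X_def)

lemma X_deriv: "t \<in> {a..b} \<Longrightarrow> (X has_real_derivative \<Psi>' t) (at t within {a..b})"
  unfolding X_def[abs_def] using deriv by (auto intro!: derivative_eq_intros)

lemma X_strict_mono: "strict_mono_on {a..b} X"
  by (rule strict_mono_on_Icc_deriv_pos[OF X_deriv deriv_pos])

lemma X_less: "a \<le> s \<Longrightarrow> s < t \<Longrightarrow> t \<le> b \<Longrightarrow> X s < X t"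
  using strict_mono_onD[OF X_strict_mono, of s t] by auto

lemma X_le: "a \<le> s \<Longrightarrow> s \<le> t \<Longrightarrow> t \<le> b \<Longrightarrow> X s \<le> X t"
  using strict_mono_on_leD[OF X_strict_mono, of s t] by auto

lemma X_pos: "a < t \<Longrightarrow> t \<le> b \<Longrightarrow> 0 < X t"
  using X_less[of a t] by simp

lemma continuous_on_X: "continuous_on {a..b} X"
  using X_deriv DERIV_continuous_on by blast

lemma X_image: "a \<le> t \<Longrightarrow> t \<le> b \<Longrightarrow> X ` {a..t} = {0..X t}"
proof (intro equalityI subsetI)
  fix u assume t: "a \<le> t" "t \<le> b" and "u \<in> {0..X t}"
  then show "u \<in> X ` {a..t}"
    using IVT'[of X a u t] continuous_on_subset[OF continuous_on_X, of "{a..t}"] by auto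
next
  fix u assume t: "a \<le> t" "t \<le> b" and "u \<in> X ` {a..t}"
  then show "u \<in> {0..X t}" using X_le[of a] X_le[of _ t] by fastforce
qed

lemma X_inverse:
  obtains T where "continuous_on {0..X b} T" "\<And>t. t \<in> {a..b} \<Longrightarrow> T (X t) = t"
proof -
  have inj: "inj_on X {a..b}" using X_strict_mono by (rule strict_mono_on_imp_inj_on)
  have "continuous_on (X ` {a..b}) (the_inv_into {a..b} X)"
    using continuous_on_X inj by (intro continuous_on_inv) (auto simp: the_inv_into_f_f)
  then show thesis
    using that[of "the_inv_into {a..b} X"] inj X_image[of b] ab by (auto simp: the_inv_into_f_f)
qed

text \<open>Composition with \<open>X\<close> or with its continuous inverse carries continuous
  functions between \<open>{a..b}\<close> and \<open>{0..X b}\<close>, and the weights cancel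
  because \<open>X t > 0\<close> for \<open>t > a\<close>. From here on a weighted function is
  represented by its continuous factor \<open>g\<close>.\<close>

lemma wC_iff:
  "wC \<Psi> a b \<rho> h \<longleftrightarrow>
     (\<exists>g. continuous_on {0..X b} g \<and> (\<forall>t\<in>{a<..b}. h t = X t powr (\<rho> - 1) * g (X t)))"
proof
  assume "wC \<Psi> a b \<rho> h"
  then obtain g where g: "continuous_on {a..b} g" "\<forall>t\<in>{a<..b}. g t = X t powr (1 - \<rho>) * h t"
    unfolding wC_def X_def by blast
  obtain T where T: "continuous_on {0..X b} T" "\<And>t. t \<in> {a..b} \<Longrightarrow> T (X t) = t"
    using X_inverse by blast
  have "T ` {0..X b} \<subseteq> {a..b}"
    using T(2) X_image[of b] ab by (auto simp flip: X_image)
  then have "continuous_on {0..X b} (\<lambda>x. g (T x))"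
    using continuous_on_compose2[OF g(1) T(1)] by blast
  moreover have "h t = X t powr (\<rho> - 1) * g (T (X t))" if t: "t \<in> {a<..b}" for t
  proof -
    have "X t powr (\<rho> - 1) * X t powr (1 - \<rho>) = 1"
      using X_pos[of t] t by (simp flip: powr_add)
    then show ?thesis using g(2) t T(2)[of t] by (simp flip: mult.assoc)
  qed
  ultimately show "\<exists>g. continuous_on {0..X b} g \<and> (\<forall>t\<in>{a<..b}. h t = X t powr (\<rho> - 1) * g (X t))"
    by blast
next
  assume "\<exists>g. continuous_on {0..X b} g \<and> (\<forall>t\<in>{a<..b}. h t = X t powr (\<rho> - 1) * g (X t))"
  then obtain g where g: "continuous_on {0..X b} g" "\<forall>t\<in>{a<..b}. h t = X t powr (\<rho> - 1) * g (X t)"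
    by blast
  have "continuous_on {a..b} (\<lambda>t. g (X t))"
    using continuous_on_compose2[OF g(1) continuous_on_X] X_image[of b] ab by auto
  moreover have "g (X t) = X t powr (1 - \<rho>) * h t" if t: "t \<in> {a<..b}" for t
  proof -
    have "X t powr (1 - \<rho>) * X t powr (\<rho> - 1) = 1"
      using X_pos[of t] t by (simp flip: powr_add)
    then show ?thesis using g(2) t by (simp flip: mult.assoc)
  qed
  ultimately show "wC \<Psi> a b \<rho> h" unfolding wC_def X_def by blast
qed

lemma frac_int_eq:
  assumes "t \<in> {a<..b}" "0 \<le> \<alpha>" "0 < p" "continuous_on {0..X b} g"
    and "\<And>s. s \<in> {a<..t} \<Longrightarrow> h s = X s powr (p - 1) * g (X s)"
  shows "frac_int \<alpha> \<Psi> \<Psi>' a h t = X t powr (\<alpha> + p - 1) * ek_int \<alpha> p g (X t)"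
  unfolding X_def
proof (rule frac_int_eq_ek_int)
  show "(\<Psi> has_real_derivative \<Psi>' s) (at s within {a..t})" if "s \<in> {a..t}" for s
    using DERIV_subset[OF deriv[of s]] that assms(1) by auto
  show "continuous_on {0..\<Psi> t - \<Psi> a} g"
    using continuous_on_subset[OF assms(4)] X_le[of t b] assms(1) by (auto simp: X_def)
qed (use assms deriv_pos in \<open>auto simp: X_def\<close>)

text \<open>A quotient of two difference quotients in \<open>t\<close>. Its limit is the operator
  \<open>(1 / \<Psi>') d/dt\<close> inside the Hilfer derivative, seen as differentiation in the
  variable \<open>x\<close>.\<close>

lemma difference_quotient_tendsto:
  assumes "t \<in> {a..b}" "((\<lambda>s. \<Phi> (X s)) has_real_derivative d) (at t within {a..b})"
  shows "((\<lambda>s. (\<Phi> (X s) - \<Phi> (X t)) / (X s - X t)) \<longlongrightarrow> d / \<Psi>' t) (at t within {a..b})"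
proof -
  have "((\<lambda>s. ((\<Phi> (X s) - \<Phi> (X t)) / (s - t)) / ((X s - X t) / (s - t))) \<longlongrightarrow> d / \<Psi>' t) (at t within {a..b})"
    using assms X_deriv[OF assms(1)] deriv_pos[OF assms(1)]
    by (intro tendsto_divide) (auto simp: has_field_derivative_iff)
  then show ?thesis
    by (rule Lim_transform_eventually) (auto simp: eventually_at_filter)
qed

text \<open>Near \<open>t\<close> the difference quotient is close to its limit, and away from
  \<open>t\<close> it is continuous on a compact set; one constant bounds both. A Lipschitz
  condition at this single point is what makes the Marchaud kernel integrable.\<close>

lemma Lipschitz_at:
  assumes cont: "continuous_on {0..X b} \<Phi>" and t: "t \<in> {a..b}"
    and d: "((\<lambda>s. \<Phi> (X s)) has_real_derivative d) (at t within {a..b})"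
  obtains C where "\<And>y. y \<in> {0..X b} \<Longrightarrow> \<bar>\<Phi> y - \<Phi> (X t)\<bar> \<le> C * \<bar>y - X t\<bar>"
proof -
  define Q where "Q s = (\<Phi> (X s) - \<Phi> (X t)) / (X s - X t)" for s
  have Qt: "(Q \<longlongrightarrow> d / \<Psi>' t) (at t within {a..b})"
    unfolding Q_def[abs_def] by (rule difference_quotient_tendsto[OF t d])
  from tendstoD[OF Qt zero_less_one] obtain e where e: "0 < e"
    "\<And>s. s \<in> {a..b} \<Longrightarrow> s \<noteq> t \<Longrightarrow> dist s t < e \<Longrightarrow> dist (Q s) (d / \<Psi>' t) < 1"
    unfolding eventually_at by blast
  have contX: "continuous_on {a..b} (\<lambda>s. \<Phi> (X s))"
    using continuous_on_compose2[OF cont continuous_on_X] X_image[of b] ab by auto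
  have Xne: "X s \<noteq> X t" if "s \<in> {a..b}" "s \<noteq> t" for s
    using X_less[of s t] X_less[of t s] that t by (cases "s < t") auto
  have "continuous_on ({a..b} - ball t e) Q"
    unfolding Q_def[abs_def]
  proof (intro continuous_intros continuous_on_subset[OF contX] continuous_on_subset[OF continuous_on_X])
    show "\<forall>s\<in>{a..b} - ball t e. X s - X t \<noteq> 0" using e(1) Xne by fastforce
  qed auto
  then have "bounded (Q ` ({a..b} - ball t e))"
    by (intro compact_imp_bounded compact_continuous_image compact_diff) auto
  then obtain M where M: "\<And>s. s \<in> {a..b} - ball t e \<Longrightarrow> \<bar>Q s\<bar> \<le> M"
    unfolding bounded_iff by (metis imageI real_norm_def)
  define C where "C = max M (\<bar>d / \<Psi>' t\<bar> + 1)"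
  have "\<bar>\<Phi> y - \<Phi> (X t)\<bar> \<le> C * \<bar>y - X t\<bar>" if "y \<in> {0..X b}" for y
  proof -
    have "y \<in> X ` {a..b}" using that X_image[of b] ab by simp
    then obtain s where s: "s \<in> {a..b}" "y = X s" by blast
    show ?thesis
    proof (cases "s = t")
      case False
      have "\<bar>Q s\<bar> \<le> C"
      proof (cases "dist s t < e")
        case True
        then show ?thesis using e(2)[OF s(1) False] unfolding C_def dist_real_def by linarith
      next
        case F: False
        then show ?thesis using M[of s] s by (auto simp: C_def dist_commute)
      qed
      then have "\<bar>Q s\<bar> * \<bar>X s - X t\<bar> \<le> C * \<bar>X s - X t\<bar>" by (rule mult_right_mono) simp
      then show ?thesis using Xne[OF s(1) False] s(2) by (simp add: Q_def abs_divide)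
    qed (use s in simp)
  qed
  then show thesis by (rule that)
qed

text \<open>Integration by parts: \<open>G\<close> is an antiderivative of the integrand which stays continuous at \<open>t\<close>
  because \<open>\<Phi>\<close> is Lipschitz at \<open>X t\<close>.\<close>

lemma marchaud_representation:
  assumes t: "t \<in> {a<..b}" and \<beta>: "0 < \<beta>" "\<beta> < 1" and cont: "continuous_on {0..X b} \<Phi>"
    and d: "\<And>s. s \<in> {a<..<t} \<Longrightarrow> ((\<lambda>s. \<Phi> (X s)) has_real_derivative d s) (at s)"
    and Lip: "\<And>y. y \<in> {0..X b} \<Longrightarrow> \<bar>\<Phi> y - \<Phi> (X t)\<bar> \<le> C * \<bar>y - X t\<bar>"
  shows "integral {a..t} (\<lambda>s. (X t - X s) powr (\<beta> - 1) * d s)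
    = X t powr (\<beta> - 1) * (\<Phi> (X t) - \<Phi> 0)
       - (1 - \<beta>) * integral {0..X t} (\<lambda>s. (X t - s) powr (\<beta> - 2) * (\<Phi> s - \<Phi> (X t)))"
proof -
  define x where "x = X t"
  define m where "m s = (x - s) powr (\<beta> - 2) * (\<Phi> s - \<Phi> x)" for s
  define P where "P y = (\<Phi> y - \<Phi> x) * (x - y) powr (\<beta> - 1)" for y
  define G where "G s = P (X s) - (1 - \<beta>) * integral {0..X s} m" for s
  have x: "0 < x" "x \<le> X b" using X_pos[of t] X_le[of t b] t by (auto simp: x_def)
  have contx: "continuous_on {0..x} \<Phi>" using continuous_on_subset[OF cont] x by auto
  have Lip': "\<bar>\<Phi> y - \<Phi> x\<bar> \<le> C * \<bar>y - x\<bar>" if "y \<in> {0..x}" for y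
    using Lip[of y] that x by (auto simp: x_def)
  have int_m: "m integrable_on {0..x}"
    unfolding m_def[abs_def]
    using marchaud_kernel_absolutely_integrable[OF x(1) \<beta>(1) contx Lip']
    by (rule set_lebesgue_integral_eq_integral(1))
  have contXt: "continuous_on {a..t} X" using continuous_on_subset[OF continuous_on_X] t by auto
  have imgXt: "X ` {a..t} \<subseteq> {0..x}" using X_image[of t] t by (auto simp: x_def)
  have contP: "continuous_on {0..x} P"
    unfolding continuous_on_def
  proof
    fix y assume y: "y \<in> {0..x}"
    show "(P \<longlongrightarrow> P y) (at y within {0..x})"
    proof (cases "y = x")
      case False
      have "((\<lambda>y. (\<Phi> y - \<Phi> x) * (x - y) powr (\<beta> - 1)) \<longlongrightarrow> (\<Phi> y - \<Phi> x) * (x - y) powr (\<beta> - 1)) (at y within {0..x})"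
        using contx y False by (intro tendsto_intros) (auto simp: continuous_on_def)
      then show ?thesis by (simp add: P_def[abs_def])
    next
      case True
      have "((\<lambda>z. x - z) \<longlongrightarrow> x - x) (at x within {0..x})" by (intro tendsto_intros)
      then have "((\<lambda>z. (x - z) powr \<beta>) \<longlongrightarrow> 0) (at x within {0..x})"
        using \<beta> by (intro tendsto_zero_powrI[of _ _ _ \<beta>]) (auto simp: eventually_at_filter)
      then have "((\<lambda>z. C * (x - z) powr \<beta>) \<longlongrightarrow> 0) (at x within {0..x})"
        by (rule tendsto_mult_right_zero)
      moreover have "\<forall>\<^sub>F z in at x within {0..x}. norm (P z) \<le> C * (x - z) powr \<beta>"
        unfolding eventually_at_filter
      proof (intro always_eventually allI impI)
        fix z assume z: "z \<noteq> x" "z \<in> {0..x}"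
        have "norm (P z) \<le> C * \<bar>z - x\<bar> * (x - z) powr (\<beta> - 1)"
          unfolding P_def using Lip'[OF z(2)] by (simp add: abs_mult mult_right_mono)
        also have "\<dots> = C * ((x - z) powr 1 * (x - z) powr (\<beta> - 1))"
          using z by simp
        also have "(x - z) powr 1 * (x - z) powr (\<beta> - 1) = (x - z) powr \<beta>"
          unfolding powr_add[symmetric] by simp
        finally show "norm (P z) \<le> C * (x - z) powr \<beta>" .
      qed
      ultimately have "(P \<longlongrightarrow> 0) (at x within {0..x})" by (rule Lim_null_comparison[rotated])
      then show ?thesis using True by (simp add: P_def)
    qed
  qed
  \<comment> \<open>In its interior form the fundamental theorem asks for the derivative of
    \<open>G\<close> on the open interval and delivers existence of the Henstock-Kurzweil integral
    together with its value.\<close>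
  have "((\<lambda>s. (x - X s) powr (\<beta> - 1) * d s) has_integral (G t - G a)) {a..t}"
  proof (rule fundamental_theorem_of_calculus_interior)
    show "a \<le> t" using t by simp
    have "continuous_on {0..x} (\<lambda>y. integral {0..y} m)"
      by (rule indefinite_integral_continuous_1[OF int_m])
    then show "continuous_on {a..t} G"
      unfolding G_def
      by (intro continuous_intros continuous_on_compose2[OF contP contXt imgXt]
          continuous_on_compose2[OF _ contXt imgXt])
    fix s assume s: "s \<in> {a<..<t}"
    have Xs: "0 < X s" "X s < x" using X_pos[of s] X_less[of s t] s t by (auto simp: x_def)
    have dX: "(X has_real_derivative \<Psi>' s) (at s)"
      using X_deriv[of s] at_within_Icc_at[of a s b] s t by auto
    have "(m \<longlongrightarrow> m (X s)) (at (X s) within {0..x})"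
      unfolding m_def using contx Xs by (intro tendsto_intros) (auto simp: continuous_on_def)
    then have "continuous (at (X s) within {0..x}) m" by (simp add: continuous_within)
    from integral_has_vector_derivative_continuous_at[where S = "{}", OF int_m, simplified, OF _ this]
    have "((\<lambda>y. integral {0..y} m) has_real_derivative m (X s)) (at (X s) within {0..x})"
      using Xs by (simp add: has_real_derivative_iff_has_vector_derivative)
    then have dM: "((\<lambda>y. integral {0..y} m) has_real_derivative m (X s)) (at (X s))"
      using at_within_Icc_at[of 0 "X s" x] Xs by simp
    have dpow: "((\<lambda>s. (x - X s) powr (\<beta> - 1)) has_real_derivative
        (\<beta> - 1) * (x - X s) powr (\<beta> - 2) * (- \<Psi>' s)) (at s)"
      using dX Xs by (auto intro!: derivative_eq_intros)
    have "(G has_real_derivative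
        (d s * (x - X s) powr (\<beta> - 1)
          + ((\<beta> - 1) * (x - X s) powr (\<beta> - 2) * (- \<Psi>' s)) * (\<Phi> (X s) - \<Phi> x))
        - (1 - \<beta>) * (m (X s) * \<Psi>' s)) (at s)"
      unfolding G_def[abs_def] P_def
      using d[OF s] by (intro DERIV_diff DERIV_mult DERIV_cmult dpow DERIV_chain2[OF dM dX]) (auto intro!: derivative_eq_intros)
    \<comment> \<open>Differentiating the power in \<open>P\<close> produces
      \<open>(1 - \<beta>) * m (X s) * \<Psi>' s\<close>, which the integral term of
      \<open>G\<close> is designed to cancel.\<close>
    moreover have "(d s * (x - X s) powr (\<beta> - 1)
          + ((\<beta> - 1) * (x - X s) powr (\<beta> - 2) * (- \<Psi>' s)) * (\<Phi> (X s) - \<Phi> x))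
        - (1 - \<beta>) * (m (X s) * \<Psi>' s) = (x - X s) powr (\<beta> - 1) * d s"
      by (simp add: m_def algebra_simps)
    ultimately show "(G has_vector_derivative (x - X s) powr (\<beta> - 1) * d s) (at s)"
      by (simp only: has_real_derivative_iff_has_vector_derivative)
  qed
  then have "integral {a..t} (\<lambda>s. (x - X s) powr (\<beta> - 1) * d s) = G t - G a"
    by (rule integral_unique)
  also have "\<dots> = x powr (\<beta> - 1) * (\<Phi> x - \<Phi> 0) - (1 - \<beta>) * integral {0..x} m"
    using x by (simp add: G_def P_def x_def[symmetric] algebra_simps)
  finally show ?thesis by (simp add: m_def[abs_def] x_def)
qed

end


section \<open>From the differential to the integral equation\<close>

text \<open>For order 1 the kernel is constant, so the function is the ordinary primitive of
  \<open>s powr (p - 1) * g s\<close>.\<close>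

lemma ek_int_one_has_derivative:
  assumes "0 < p" "continuous_on {0..B} g" "0 < x" "x < B"
  shows "((\<lambda>x. x powr p * ek_int 1 p g x) has_real_derivative x powr (p - 1) * g x) (at x)"
proof -
  define h where "h s = s powr (p - 1) * g s" for s
  have rep: "h integrable_on {0..y}" "integral {0..y} h = y powr p * ek_int 1 p g y"
    if y: "0 < y" "y \<le> B" for y
  proof -
    have 1: "(\<lambda>s. (y - s) powr (1 - 1) * h s) integrable_on {0..y}"
      "integral {0..y} (\<lambda>s. (y - s) powr (1 - 1) * h s) = y powr p * ek_int 1 p g y"
      using ek_int_eq_integral[of y 1 p g h] y assms continuous_on_subset[OF assms(2), of "{0..y}"]
      by (auto simp: h_def intro: set_lebesgue_integral_eq_integral)
    \<comment> \<open>By convention \<open>0 powr 0 = 0\<close>, so the kernel of order 1 equals 1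
      except at \<open>s = y\<close>.\<close>
    have 2: "h s = (y - s) powr (1 - 1) * h s" if "s \<in> {0..y} - {y}" for s using that by simp
    show "h integrable_on {0..y}"
      by (rule integrable_spike[OF 1(1), of "{y}"]) (use 2 in auto)
    have "integral {0..y} h = integral {0..y} (\<lambda>s. (y - s) powr (1 - 1) * h s)"
      by (rule integral_spike[of "{y}"]) (use 2 in auto)
    then show "integral {0..y} h = y powr p * ek_int 1 p g y" using 1(2) by simp
  qed
  have "(h \<longlongrightarrow> h x) (at x within {0..B})"
    unfolding h_def using assms by (intro tendsto_intros) (auto simp: continuous_on_def)
  then have "continuous (at x within {0..B}) h" by (simp add: continuous_within)
  from integral_has_vector_derivative_continuous_at[where S = "{}", OF rep(1)[of B], simplified, OF _ _ this]
  have "((\<lambda>y. integral {0..y} h) has_real_derivative h x) (at x within {0..B})"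
    using assms by (simp add: has_real_derivative_iff_has_vector_derivative)
  then have "((\<lambda>y. integral {0..y} h) has_real_derivative h x) (at x)"
    using at_within_Icc_at[of 0 x B] assms by simp
  then have "((\<lambda>x. x powr p * ek_int 1 p g x) has_real_derivative h x) (at x)"
    by (rule has_field_derivative_transform_within_open[of _ _ _ "{0<..<B}"]) (use assms rep(2) in auto)
  then show ?thesis by (simp add: h_def)
qed

text \<open>Otherwise \<open>N - W\<close> or \<open>N + W\<close> has a negative derivative at
  \<open>x\<close> and decreases strictly just to the right, against the bound on the
  increments.\<close>

lemma abs_derivative_le:
  fixes W N :: "real \<Rightarrow> real"
  assumes "(W has_real_derivative w) (at x)" "(N has_real_derivative n) (at x)" "x < B"
    and le: "\<And>y. x < y \<Longrightarrow> y < B \<Longrightarrow> \<bar>W y - W x\<bar> \<le> N y - N x"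
  shows "\<bar>w\<bar> \<le> n"
proof (rule ccontr)
  assume "\<not> \<bar>w\<bar> \<le> n"
  then consider "n - w < 0" | "n + w < 0" by linarith
  then show False
  proof cases
    case 1
    have "((\<lambda>y. N y - W y) has_real_derivative n - w) (at x)" by (intro DERIV_diff assms)
    from has_real_derivative_neg_dec_right[OF this 1] obtain d where
      d: "0 < d" "\<And>h. 0 < h \<Longrightarrow> h < d \<Longrightarrow> N (x + h) - W (x + h) < N x - W x" by auto
    define h where "h = min d (B - x) / 2"
    have "0 < h" "h < d" "x + h < B" using d(1) assms(3) by (auto simp: h_def min_def field_simps)
    then show False using d(2)[of h] le[of "x + h"] by auto
  next
    case 2
    have "((\<lambda>y. N y + W y) has_real_derivative n + w) (at x)" by (intro DERIV_add assms)
    from has_real_derivative_neg_dec_right[OF this 2] obtain d where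
      d: "0 < d" "\<And>h. 0 < h \<Longrightarrow> h < d \<Longrightarrow> N (x + h) + W (x + h) < N x + W x" by auto
    define h where "h = min d (B - x) / 2"
    have "0 < h" "h < d" "x + h < B" using d(1) assms(3) by (auto simp: h_def min_def field_simps)
    then show False using d(2)[of h] le[of "x + h"] by auto
  qed
qed

lemma continuous_on_powr_nonneg:
  fixes q :: real
  assumes "0 < q"
  shows "continuous_on {0..B} (\<lambda>x. x powr q)"
  using assms by (intro continuous_on_powr') (auto intro!: continuous_intros)

lemma continuous_on_powr_ek_int:
  assumes "0 < q" "0 \<le> \<alpha>" "0 < p" "continuous_on {0..B} g"
  shows "continuous_on {0..B} (\<lambda>x. x powr q * ek_int \<alpha> p g x)"
  using assms by (intro continuous_on_mult continuous_on_powr_nonneg continuous_on_ek_int)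

text \<open>Here \<open>D\<close> plays the role of the integral of the defect of the differential equation; applying the
  fractional integral of order \<open>\<mu>\<close> to it gives the ordinary integral \<open>W\<close> of the defect of the integral
  equation.\<close>

lemma integral_equation_defect_bound:
  fixes \<mu> \<beta> \<rho> :: real
  assumes \<mu>: "0 < \<mu>" and \<beta>: "0 \<le> \<beta>" and \<rho>: "\<rho> = \<mu> + \<beta>" "\<rho> \<le> 1" and B: "0 < B"
    and cg: "continuous_on {0..B} g" and cf: "continuous_on {0..B} f"
    and D: "\<And>x. D x = x powr \<beta> * ek_int \<beta> 1 (\<lambda>s. ek_int (1 - \<rho>) \<rho> g s - ek_int (1 - \<rho>) \<rho> g 0) x
                - x powr \<rho> * ek_int 1 \<rho> f x"
    and cD: "continuous_on {0..B} D"
    and Lip: "\<And>x y. 0 \<le> x \<Longrightarrow> x \<le> y \<Longrightarrow> y \<le> B \<Longrightarrow> \<bar>D y - D x\<bar> \<le> \<epsilon> * (y - x)"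
    and x: "x \<in> {0..B}"
  shows "\<bar>g x - g 0 - x powr \<mu> * ek_int \<mu> \<rho> f x\<bar> \<le> \<epsilon> / Gamma (1 + \<mu>) * x powr (\<mu> + 1 - \<rho>)"
proof -
  define \<Phi> where "\<Phi> = ek_int (1 - \<rho>) \<rho> g"
  \<comment> \<open>The defect of the integral equation with the weight
    \<open>x powr (\<rho> - 1)\<close> divided out; \<open>g 0\<close> stands for the initial value
    divided by \<open>Gamma \<rho>\<close>.\<close>
  define v where "v x = g x - g 0 - x powr \<mu> * ek_int \<mu> \<rho> f x" for x
  define W where "W x = x powr \<rho> * ek_int 1 \<rho> v x" for x
  \<comment> \<open>The fractional integral of order \<open>\<mu>\<close> of
    \<open>\<epsilon> * s\<close>, the largest function that the Lipschitz bound and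
    \<open>D 0 = 0\<close> allow for \<open>D\<close>.\<close>
  define N where "N x = \<epsilon> * x powr (1 + \<mu>) / Gamma (2 + \<mu>)" for x
  have \<rho>0: "0 < \<rho>" using \<mu> \<beta> \<rho> by simp
  have c\<Phi>: "continuous_on {0..B} \<Phi>"
    unfolding \<Phi>_def using \<rho> \<rho>0 cg by (intro continuous_on_ek_int) auto
  have c3: "continuous_on {0..B} (\<lambda>x. x powr \<mu> * ek_int \<mu> \<rho> f x)"
    using \<mu> \<rho>0 cf by (intro continuous_on_powr_ek_int) auto
  have cv: "continuous_on {0..B} v"
    unfolding v_def by (intro continuous_intros cg c3)
  \<comment> \<open>Both sides reduce by the semigroup law to the same expression: the orders add up
    as \<open>\<beta> + \<mu> = \<rho>\<close> and \<open>(1 - \<rho>) + \<rho> = 1\<close>, and the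
    constant \<open>\<Phi> 0 = g 0 * Gamma \<rho>\<close> matches the subtracted
    \<open>g 0\<close>.\<close>
  have W_eq: "W x = x powr \<mu> * ek_int \<mu> 1 D x" if x: "0 < x" "x \<le> B" for x
  proof -
    have x': "0 \<le> x" using x by simp
    have "ek_int 1 \<rho> v x = ek_int 1 \<rho> (\<lambda>s. g s - g 0) x - ek_int 1 \<rho> (\<lambda>s. s powr \<mu> * ek_int \<mu> \<rho> f s) x"
      unfolding v_def using x \<rho>0 c3 cg by (intro ek_int_diff[of _ _ B] continuous_on_diff) auto
    also have "ek_int 1 \<rho> (\<lambda>s. g s - g 0) x = ek_int 1 \<rho> g x - ek_int 1 \<rho> (\<lambda>s. g 0) x"
      using x \<rho>0 cg by (intro ek_int_diff[of _ _ B]) auto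
    also have "ek_int 1 \<rho> (\<lambda>s. g 0) x = g 0 * (Gamma \<rho> / Gamma (\<rho> + 1))"
      using \<rho>0 by (intro ek_int_const) auto
    also have "ek_int 1 \<rho> (\<lambda>s. s powr \<mu> * ek_int \<mu> \<rho> f s) x = x powr \<mu> * ek_int (\<mu> + 1) \<rho> f x"
      using ek_int_semigroup[of \<mu> 1 \<rho> B f x] x \<rho>0 \<mu> cf by (simp add: ek_int_powr_mult)
    finally have 1: "ek_int 1 \<rho> v x = ek_int 1 \<rho> g x - g 0 * (Gamma \<rho> / Gamma (\<rho> + 1)) - x powr \<mu> * ek_int (\<mu> + 1) \<rho> f x" .
    define k where "k = ek_int \<beta> 1 (\<lambda>s. \<Phi> s - \<Phi> 0)"
    have ck: "continuous_on {0..B} k"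
      unfolding k_def using \<beta> c\<Phi> by (intro continuous_on_ek_int continuous_intros) auto
    have c4: "continuous_on {0..B} (\<lambda>x. x powr \<rho> * ek_int 1 \<rho> f x)"
      using \<rho>0 cf by (intro continuous_on_powr_ek_int) auto
    \<comment> \<open>Read off from the continuity of \<open>D\<close>: for
      \<open>\<beta> = 0\<close> the factor \<open>s powr \<beta>\<close> jumps at 0, so this is not
      simply a product of continuous functions.\<close>
    have c5: "continuous_on {0..B} (\<lambda>s. s powr \<beta> * k s)"
    proof -
      have "continuous_on {0..B} (\<lambda>x. D x + x powr \<rho> * ek_int 1 \<rho> f x)"
        by (intro continuous_intros cD c4)
      then show ?thesis by (simp add: D k_def \<Phi>_def)
    qed
    have "ek_int \<mu> 1 D x = ek_int \<mu> 1 (\<lambda>s. s powr \<beta> * k s - s powr \<rho> * ek_int 1 \<rho> f s) x"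
      by (simp add: D[abs_def] k_def \<Phi>_def)
    also have "\<dots> = ek_int \<mu> 1 (\<lambda>s. s powr \<beta> * k s) x - ek_int \<mu> 1 (\<lambda>s. s powr \<rho> * ek_int 1 \<rho> f s) x"
      using x \<mu> c4 c5 by (intro ek_int_diff[of _ _ B]) auto
    also have "ek_int \<mu> 1 (\<lambda>s. s powr \<rho> * ek_int 1 \<rho> f s) x = x powr \<rho> * ek_int (\<mu> + 1) \<rho> f x"
      using ek_int_semigroup[of 1 \<mu> \<rho> B f x] x \<rho>0 \<mu> cf by (simp add: ek_int_powr_mult add.commute)
    also have "ek_int \<mu> 1 (\<lambda>s. s powr \<beta> * k s) x = x powr \<beta> * ek_int \<rho> 1 (\<lambda>s. \<Phi> s - \<Phi> 0) x"
      using ek_int_semigroup[of \<beta> \<mu> 1 B "\<lambda>s. \<Phi> s - \<Phi> 0" x] x \<beta> \<mu> \<rho> c\<Phi>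
      by (simp add: ek_int_powr_mult k_def add.commute continuous_on_diff)
    also have "ek_int \<rho> 1 (\<lambda>s. \<Phi> s - \<Phi> 0) x = ek_int \<rho> 1 \<Phi> x - ek_int \<rho> 1 (\<lambda>s. \<Phi> 0) x"
      using x \<rho>0 c\<Phi> by (intro ek_int_diff[of _ _ B]) auto
    also have "ek_int \<rho> 1 \<Phi> x = ek_int 1 \<rho> g x"
      using ek_int_semigroup[of "1 - \<rho>" \<rho> \<rho> B g x] x \<rho>0 \<rho> cg by (simp add: \<Phi>_def)
    also have "ek_int \<rho> 1 (\<lambda>s. \<Phi> 0) x = g 0 * (Gamma \<rho> / Gamma (\<rho> + 1))"
    proof -
      have "\<Phi> 0 = g 0 * Gamma \<rho>"
        unfolding \<Phi>_def using ek_int_at_zero[of "1 - \<rho>" \<rho> g] \<rho>0 \<rho> by simp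
      then show ?thesis using ek_int_const[of \<rho> 1 "\<Phi> 0" x] \<rho>0 by (simp add: add.commute)
    qed
    finally have 2: "ek_int \<mu> 1 D x = x powr \<beta> * (ek_int 1 \<rho> g x - g 0 * (Gamma \<rho> / Gamma (\<rho> + 1)))
        - x powr \<rho> * ek_int (\<mu> + 1) \<rho> f x" .
    have "x powr \<rho> = x powr \<mu> * x powr \<beta>" unfolding \<rho>(1) by (rule powr_add)
    then show ?thesis unfolding W_def 1 2 by (simp add: algebra_simps)
  qed
  have D0: "D 0 = 0" by (simp add: D)
  have Dle: "\<bar>D s\<bar> \<le> \<epsilon> * s powr 1" if "0 < s" "s \<le> B" for s
    using Lip[of 0 s] that D0 by simp
  have \<epsilon>: "0 \<le> \<epsilon>" using order_trans[OF abs_ge_zero Lip[of 0 B]] B by (simp add: zero_le_mult_iff)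
  have G2: "Gamma (2 + \<mu>) > 0" "Gamma (2 + \<mu>) = (1 + \<mu>) * Gamma (1 + \<mu>)" "Gamma (1 + \<mu>) > 0"
    using \<mu> Gamma_one_plus[of "1 + \<mu>"] by (auto intro!: Gamma_real_pos)
  \<comment> \<open>The increment is split so that the kernel integral and the power change one at a
    time. The bounds on \<open>D\<close> and on its increments are equalities for
    \<open>D s = \<epsilon> * s\<close>, which is why they recombine to exactly
    \<open>N y - N x\<close>.\<close>
  have W_le: "\<bar>W y - W x\<bar> \<le> N y - N x" if xy: "0 < x" "x < y" "y < B" for x y
  proof -
    have "\<bar>ek_int \<mu> 1 D y - ek_int \<mu> 1 D x\<bar> \<le> \<epsilon> * (y - x) * (Gamma (1 + 1) / Gamma (1 + 1 + \<mu>))"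
    proof (rule ek_int_diff_bound)
      fix u :: real assume u: "0 < u" "u \<le> 1"
      have "y * u \<le> y * 1" using u xy by (intro mult_left_mono) auto
      then have "y * u \<le> B" using xy by linarith
      moreover have "x * u \<le> y * u" using u xy by simp
      ultimately have "\<bar>D (y * u) - D (x * u)\<bar> \<le> \<epsilon> * (y * u - x * u)" using u xy by (intro Lip) auto
      then show "\<bar>D (y * u) - D (x * u)\<bar> \<le> \<epsilon> * (y - x) * u powr 1" using u by (simp add: algebra_simps)
    qed (use \<mu> xy cD in \<open>auto intro!: continuous_on_scaled_arg[of B]\<close>)
    then have d1: "\<bar>ek_int \<mu> 1 D y - ek_int \<mu> 1 D x\<bar> \<le> \<epsilon> * (y - x) / Gamma (2 + \<mu>)"
      by (simp add: Gamma_numeral)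
    have "\<bar>ek_int \<mu> 1 D x\<bar> \<le> \<epsilon> * x powr 1 * (Gamma (1 + 1) / Gamma (1 + 1 + \<mu>))"
      using \<mu> xy cD Dle by (intro ek_int_bound[of _ _ _ B]) auto
    then have d2: "\<bar>ek_int \<mu> 1 D x\<bar> \<le> \<epsilon> * x / Gamma (2 + \<mu>)"
      using xy by (simp add: Gamma_numeral)
    have mono: "x powr \<mu> \<le> y powr \<mu>" using xy \<mu> by (intro powr_mono2) auto
    have "W y - W x = y powr \<mu> * (ek_int \<mu> 1 D y - ek_int \<mu> 1 D x) + (y powr \<mu> - x powr \<mu>) * ek_int \<mu> 1 D x"
      using W_eq[of x] W_eq[of y] xy by (simp add: algebra_simps)
    also have "\<bar>\<dots>\<bar> \<le> y powr \<mu> * \<bar>ek_int \<mu> 1 D y - ek_int \<mu> 1 D x\<bar> + (y powr \<mu> - x powr \<mu>) * \<bar>ek_int \<mu> 1 D x\<bar>"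
      using mono by (intro order_trans[OF abs_triangle_ineq]) (simp add: abs_mult)
    also have "\<dots> \<le> y powr \<mu> * (\<epsilon> * (y - x) / Gamma (2 + \<mu>)) + (y powr \<mu> - x powr \<mu>) * (\<epsilon> * x / Gamma (2 + \<mu>))"
      using mono d1 d2 by (intro add_mono mult_left_mono) auto
    also have "\<dots> = \<epsilon> * (y powr \<mu> * y - x powr \<mu> * x) / Gamma (2 + \<mu>)"
      by (simp add: algebra_simps diff_divide_distrib add_divide_distrib)
    also have "\<dots> = N y - N x"
      using xy by (simp add: N_def powr_add algebra_simps diff_divide_distrib)
    finally show ?thesis .
  qed
  \<comment> \<open>Comparing derivatives turns the increment bound into a pointwise one:
    \<open>W\<close> has derivative \<open>x powr (\<rho> - 1) * v x\<close>, and \<open>N\<close>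
    has \<open>\<epsilon> / Gamma (1 + \<mu>) * x powr \<mu>\<close>.\<close>
  have inner: "\<bar>v x\<bar> \<le> \<epsilon> / Gamma (1 + \<mu>) * x powr (\<mu> + 1 - \<rho>)" if x: "0 < x" "x < B" for x
  proof -
    have dW: "(W has_real_derivative x powr (\<rho> - 1) * v x) (at x)"
      unfolding W_def[abs_def] using ek_int_one_has_derivative[OF \<rho>0 cv x] .
    have "(N has_real_derivative \<epsilon> * ((1 + \<mu>) * x powr (1 + \<mu> - 1)) / Gamma (2 + \<mu>)) (at x)"
      unfolding N_def[abs_def] using x
      by (intro DERIV_cdivide DERIV_cmult has_real_derivative_powr) auto
    moreover have "\<epsilon> * ((1 + \<mu>) * x powr (1 + \<mu> - 1)) / Gamma (2 + \<mu>) = \<epsilon> / Gamma (1 + \<mu>) * x powr \<mu>"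
      unfolding G2(2) using \<mu> by simp
    ultimately have dN: "(N has_real_derivative \<epsilon> / Gamma (1 + \<mu>) * x powr \<mu>) (at x)" by simp
    have "\<bar>x powr (\<rho> - 1) * v x\<bar> \<le> \<epsilon> / Gamma (1 + \<mu>) * x powr \<mu>"
      by (rule abs_derivative_le[OF dW dN x(2)]) (use W_le x in auto)
    then have "x powr (1 - \<rho>) * (x powr (\<rho> - 1) * \<bar>v x\<bar>) \<le> x powr (1 - \<rho>) * (\<epsilon> / Gamma (1 + \<mu>) * x powr \<mu>)"
      by (intro mult_left_mono) (auto simp: abs_mult)
    moreover have "x powr (1 - \<rho>) * (x powr (\<rho> - 1) * \<bar>v x\<bar>) = \<bar>v x\<bar>"
      using x by (simp add: powr_add[symmetric] flip: mult.assoc)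
    moreover have "x powr (1 - \<rho>) * (\<epsilon> / Gamma (1 + \<mu>) * x powr \<mu>) = \<epsilon> / Gamma (1 + \<mu>) * x powr (\<mu> + 1 - \<rho>)"
      using powr_add[of x \<mu> "1 - \<rho>"] by (simp add: algebra_simps)
    ultimately show ?thesis by metis
  qed
  \<comment> \<open>Derivatives were compared in the open interval; continuity carries the
    inequality to both endpoints.\<close>
  have "0 \<le> \<epsilon> / Gamma (1 + \<mu>) * x powr (\<mu> + 1 - \<rho>) - \<bar>v x\<bar>"
  proof (rule continuous_ge_on_closure[of "{0<..<B}" "\<lambda>x. \<epsilon> / Gamma (1 + \<mu>) * x powr (\<mu> + 1 - \<rho>) - \<bar>v x\<bar>"])
    have "continuous_on {0..B} (\<lambda>x. \<epsilon> / Gamma (1 + \<mu>) * x powr (\<mu> + 1 - \<rho>) - \<bar>v x\<bar>)"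
      using \<mu> \<rho> cv by (intro continuous_intros continuous_on_powr_nonneg) auto
    then show "continuous_on (closure {0<..<B}) (\<lambda>x. \<epsilon> / Gamma (1 + \<mu>) * x powr (\<mu> + 1 - \<rho>) - \<bar>v x\<bar>)"
      using B by simp
  qed (use x B inner in auto)
  then show ?thesis by (simp add: v_def)
qed


section \<open>The Hilfer derivative as a right-hand derivative\<close>

context psi_scale
begin

text \<open>The points are the images under \<open>X\<close> of \<open>t + (b - t) / Suc n\<close>,
  so limits along them are limits in \<open>t\<close>. The sequence is fixed before
  \<open>\<Phi>\<close> and \<open>d\<close>, hence serves every differentiable function at
  once.\<close>

lemma right_sequence:
  assumes "t \<in> {a<..<b}"
  obtains r where "\<And>n::nat. X t < r n" "\<And>n. r n \<le> X b" "r \<longlonglongrightarrow> X t"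
    and "\<And>\<Phi> d. ((\<lambda>s. \<Phi> (X s)) has_real_derivative d) (at t) \<Longrightarrow>
           (\<lambda>n. (\<Phi> (r n) - \<Phi> (X t)) / (r n - X t)) \<longlonglongrightarrow> d / \<Psi>' t"
proof -
  define q where "q n = t + (b - t) / real (Suc n)" for n
  have q: "t < q n" "q n \<le> b" for n
    using assms divide_left_mono[of 1 "real (Suc n)" "b - t"] by (auto simp: q_def)
  have q_lim: "q \<longlonglongrightarrow> t"
  proof -
    have "(\<lambda>n. (b - t) * inverse (real (Suc n))) \<longlonglongrightarrow> 0"
      by (rule tendsto_mult_right_zero[OF LIMSEQ_inverse_real_of_nat])
    then have "(\<lambda>n. t + (b - t) * inverse (real (Suc n))) \<longlonglongrightarrow> t + 0" by (intro tendsto_intros)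
    then show ?thesis by (simp add: q_def[abs_def] divide_inverse)
  qed
  have q_at: "filterlim q (at t within {a..b}) sequentially"
    unfolding filterlim_at using q_lim q less_imp_neq[OF q(1)] assms
    by (auto intro!: always_eventually less_imp_le intro: less_trans)
  have "(X \<longlongrightarrow> X t) (at t within {a..b})"
    using continuous_on_X assms by (auto simp: continuous_on_def)
  then have "(\<lambda>n. X (q n)) \<longlonglongrightarrow> X t" using q_at by (rule filterlim_compose)
  moreover have "(\<lambda>n. (\<Phi> (X (q n)) - \<Phi> (X t)) / (X (q n) - X t)) \<longlonglongrightarrow> d / \<Psi>' t"
    if "((\<lambda>s. \<Phi> (X s)) has_real_derivative d) (at t)" for \<Phi> d
    by (rule filterlim_compose[OF difference_quotient_tendsto q_at])
      (use that assms in \<open>auto intro: has_field_derivative_at_within\<close>)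
  moreover have "X t < X (q n)" "X (q n) \<le> X b" for n
    using X_less[of t "q n"] X_le[of "q n" b] q[of n] assms by auto
  ultimately show thesis using that[of "\<lambda>n. X (q n)"] by blast
qed

text \<open>For \<open>\<rho> = \<mu>\<close> the outer integral is the identity and both sides are
  the derivative of the inner integral in the variable \<open>x\<close>. Otherwise
  \<open>marchaud_representation\<close> and \<open>frac_int_right_derivative\<close> give the same
  Marchaud expression for the Hilfer derivative and for the right-hand derivative of
  \<open>K\<close>.\<close>

lemma hilfer_right_derivative:
  assumes \<mu>: "0 < \<mu>" "\<mu> < 1" and \<nu>: "0 \<le> \<nu>" "\<nu> \<le> 1" and \<rho>: "\<rho> = \<mu> + \<nu> - \<mu> * \<nu>"
    and g: "continuous_on {0..X b} g" "\<And>t. t \<in> {a<..b} \<Longrightarrow> y t = X t powr (\<rho> - 1) * g (X t)"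
    and ex: "hilfer_exists \<mu> \<nu> \<Psi> \<Psi>' a b y"
    and t: "t \<in> {a<..<b}"
    and K: "\<And>x. K x = x powr (\<rho> - \<mu>) *
        ek_int (\<rho> - \<mu>) 1 (\<lambda>s. ek_int (1 - \<rho>) \<rho> g s - ek_int (1 - \<rho>) \<rho> g 0) x"
  shows "\<exists>r. (\<forall>n. X t < r n) \<and> r \<longlonglongrightarrow> X t \<and>
     (\<lambda>n. (K (r n) - K (X t)) / (r n - X t)) \<longlonglongrightarrow> hilfer \<mu> \<nu> \<Psi> \<Psi>' a b y t"
proof -
  define \<beta> where "\<beta> = \<rho> - \<mu>"
  define \<Phi> where "\<Phi> = ek_int (1 - \<rho>) \<rho> g"
  define F where "F = frac_int ((1 - \<nu>) * (1 - \<mu>)) \<Psi> \<Psi>' a y"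
  define d where "d s = vector_derivative F (at s within {a..b})" for s
  have \<beta>_eq: "\<nu> * (1 - \<mu>) = \<beta>" and \<rho>_eq: "(1 - \<nu>) * (1 - \<mu>) = 1 - \<rho>"
    unfolding \<beta>_def \<rho> by (auto simp: algebra_simps)
  have "\<nu> * (1 - \<mu>) \<le> 1 * (1 - \<mu>)" using \<mu> \<nu> by (intro mult_right_mono) auto
  then have \<beta>: "0 \<le> \<beta>" "\<beta> < 1" using \<mu> \<nu> \<beta>_eq by auto
  have "0 \<le> (1 - \<nu>) * (1 - \<mu>)" using \<mu> \<nu> by simp
  then have \<rho>1: "0 < \<rho>" "\<rho> \<le> 1" using \<rho>_eq \<beta> \<mu> unfolding \<beta>_def by auto
  have c\<Phi>: "continuous_on {0..X b} \<Phi>"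
    unfolding \<Phi>_def using \<rho>1 g(1) by (intro continuous_on_ek_int) auto
  have F_eq: "F s = \<Phi> (X s)" if "s \<in> {a<..b}" for s
  proof -
    have "F s = X s powr (1 - \<rho> + \<rho> - 1) * \<Phi> (X s)"
      unfolding F_def \<rho>_eq \<Phi>_def using that \<rho>1 g by (intro frac_int_eq) auto
    then show ?thesis using X_pos[of s] that by simp
  qed
  have dF: "((\<lambda>s. \<Phi> (X s)) has_real_derivative d s) (at s)" if s: "s \<in> {a<..<b}" for s
  proof -
    have "F differentiable (at s within {a..b})"
      using ex s unfolding hilfer_exists_def F_def by auto
    then have "(F has_vector_derivative d s) (at s within {a..b})"
      unfolding d_def by (simp add: vector_derivative_works)
    then have "(F has_real_derivative d s) (at s)"
      using at_within_Icc_at[of a s b] s by (simp add: has_real_derivative_iff_has_vector_derivative)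
    then show ?thesis
      by (rule has_field_derivative_transform_within_open[of _ _ _ "{a<..<b}"]) (use s F_eq in auto)
  qed
  have x: "0 < X t" "X t < X b" using X_pos[of t] X_less[of t b] t by auto
  obtain r where r: "\<And>n::nat. X t < r n" "\<And>n. r n \<le> X b" "r \<longlonglongrightarrow> X t"
    and r_lim: "\<And>\<Phi> d. ((\<lambda>s. \<Phi> (X s)) has_real_derivative d) (at t) \<Longrightarrow>
           (\<lambda>n. (\<Phi> (r n) - \<Phi> (X t)) / (r n - X t)) \<longlonglongrightarrow> d / \<Psi>' t"
    using right_sequence[OF t] by blast
  have "(\<lambda>n. (K (r n) - K (X t)) / (r n - X t)) \<longlonglongrightarrow> hilfer \<mu> \<nu> \<Psi> \<Psi>' a b y t"
  proof (cases "\<beta> = 0")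
    case True
    have "hilfer \<mu> \<nu> \<Psi> \<Psi>' a b y t = d t / \<Psi>' t"
      unfolding hilfer_def \<beta>_eq True by (simp add: frac_int_def d_def F_def)
    moreover have "K z = \<Phi> z - \<Phi> 0" if "0 < z" for z
      using that True by (simp add: K ek_int_def \<beta>_def[symmetric] \<Phi>_def)
    then have "(\<lambda>n. (K (r n) - K (X t)) / (r n - X t)) = (\<lambda>n. (\<Phi> (r n) - \<Phi> (X t)) / (r n - X t))"
      using x r(1) less_trans[OF x(1) r(1)] by simp
    ultimately show ?thesis using r_lim[OF dF[OF t]] by simp
  next
    case False
    then have \<beta>0: "0 < \<beta>" using \<beta> by simp
    obtain C where C: "\<And>z. z \<in> {0..X b} \<Longrightarrow> \<bar>\<Phi> z - \<Phi> (X t)\<bar> \<le> C * \<bar>z - X t\<bar>"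
      using Lipschitz_at[OF c\<Phi> _ has_field_derivative_at_within[OF dF[OF t]]] t
      by (metis greaterThanLessThan_subseteq_atLeastAtMost_iff order_refl subsetD)
    have "hilfer \<mu> \<nu> \<Psi> \<Psi>' a b y t = integral {a..t} (\<lambda>s. (X t - X s) powr (\<beta> - 1) * d s) / Gamma \<beta>"
    proof -
      have "integral {a..t} (\<lambda>\<eta>. \<Psi>' \<eta> * (\<Psi> t - \<Psi> \<eta>) powr (\<beta> - 1) * (1 / \<Psi>' \<eta> * d \<eta>))
          = integral {a..t} (\<lambda>s. (X t - X s) powr (\<beta> - 1) * d s)"
      proof (rule integral_cong)
        fix s assume "s \<in> {a..t}"
        then have "\<Psi>' s \<noteq> 0" using deriv_pos[of s] t by auto
        then show "\<Psi>' s * (\<Psi> t - \<Psi> s) powr (\<beta> - 1) * (1 / \<Psi>' s * d s) = (X t - X s) powr (\<beta> - 1) * d s"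
          by (simp add: X_def)
      qed
      then show ?thesis
        unfolding hilfer_def \<beta>_eq using False by (simp add: frac_int_def d_def F_def)
    qed
    also have "\<dots> = (X t powr (\<beta> - 1) * (\<Phi> (X t) - \<Phi> 0)
       - (1 - \<beta>) * integral {0..X t} (\<lambda>s. (X t - s) powr (\<beta> - 2) * (\<Phi> s - \<Phi> (X t)))) / Gamma \<beta>"
      by (subst marchaud_representation[OF _ \<beta>0 \<beta>(2) c\<Phi> _ C]) (use t dF in auto)
    finally show ?thesis
      using frac_int_right_derivative[OF x \<beta>0 \<beta>(2) c\<Phi> C r, of K "\<Phi> 0"]
      by (simp add: K \<beta>_def[symmetric] \<Phi>_def)
  qed
  then show ?thesis using r by blast
qed

text \<open>The quotients of \<open>K\<close> tend to the Hilfer derivative and \<open>J\<close> is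
  the primitive of the right-hand side in the variable \<open>x\<close>. Hence
  \<open>D = K - J\<close> has right-hand derivatives bounded by \<open>\<epsilon>\<close> along
  suitable sequences and is Lipschitz, as \<open>integral_equation_defect_bound\<close>
  requires.\<close>

lemma hilfer_defect_bound:
  assumes \<mu>: "0 < \<mu>" "\<mu> < 1" and \<nu>: "0 \<le> \<nu>" "\<nu> \<le> 1" and \<rho>: "\<rho> = \<mu> + \<nu> - \<mu> * \<nu>"
    and g: "continuous_on {0..X b} g" "\<And>t. t \<in> {a<..b} \<Longrightarrow> y t = X t powr (\<rho> - 1) * g (X t)"
    and f: "continuous_on {0..X b} f" "\<And>t. t \<in> {a<..b} \<Longrightarrow> h t = X t powr (\<rho> - 1) * f (X t)"
    and ex: "hilfer_exists \<mu> \<nu> \<Psi> \<Psi>' a b y"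
    and le: "\<And>t. t \<in> {a<..b} \<Longrightarrow> \<bar>hilfer \<mu> \<nu> \<Psi> \<Psi>' a b y t - h t\<bar> \<le> \<epsilon>"
    and x: "x \<in> {0..X b}"
  shows "\<bar>g x - g 0 - x powr \<mu> * ek_int \<mu> \<rho> f x\<bar> \<le> \<epsilon> / Gamma (1 + \<mu>) * x powr (\<mu> + 1 - \<rho>)"
proof -
  define \<beta> where "\<beta> = \<rho> - \<mu>"
  define \<Phi> where "\<Phi> = ek_int (1 - \<rho>) \<rho> g"
  define K where "K x = x powr \<beta> * ek_int \<beta> 1 (\<lambda>s. \<Phi> s - \<Phi> 0) x" for x
  define J where "J x = x powr \<rho> * ek_int 1 \<rho> f x" for x
  define D where "D x = K x - J x" for x
  have \<beta>_eq: "\<nu> * (1 - \<mu>) = \<beta>" and \<rho>_eq: "(1 - \<nu>) * (1 - \<mu>) = 1 - \<rho>"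
    unfolding \<beta>_def \<rho> by (auto simp: algebra_simps)
  have \<beta>: "0 \<le> \<beta>" using \<mu> \<nu> unfolding \<beta>_eq[symmetric] by simp
  have "0 \<le> (1 - \<nu>) * (1 - \<mu>)" using \<mu> \<nu> by simp
  then have \<rho>1: "0 < \<rho>" "\<rho> \<le> 1" using \<rho>_eq \<beta> \<mu> unfolding \<beta>_def by auto
  have c\<Phi>: "continuous_on {0..X b} \<Phi>"
    unfolding \<Phi>_def using \<rho>1 g(1) by (intro continuous_on_ek_int) auto
  have cK: "continuous_on {0..X b} K"
  proof (cases "\<beta> = 0")
    case True
    then have "K = (\<lambda>x. x powr 0 * (\<Phi> x - \<Phi> 0))" by (simp add: K_def[abs_def] ek_int_def)
    \<comment> \<open>At \<open>x = 0\<close> the factor \<open>x powr 0\<close> is 0 instead of 1,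
      but \<open>\<Phi> x - \<Phi> 0\<close> vanishes there as well.\<close>
    also have "\<dots> = (\<lambda>x. \<Phi> x - \<Phi> 0)" by auto
    finally show ?thesis using c\<Phi> by (auto intro!: continuous_intros)
  next
    case False
    then show ?thesis
      unfolding K_def using \<beta> c\<Phi> by (intro continuous_on_powr_ek_int continuous_on_diff) auto
  qed
  have cD: "continuous_on {0..X b} D"
    unfolding D_def J_def using \<rho>1 f(1)
    by (intro continuous_on_diff cK continuous_on_powr_ek_int) auto
  have seq: "\<exists>r d. (\<forall>n. x < r n) \<and> r \<longlonglongrightarrow> x \<and> (\<lambda>n. (D (r n) - D x) / (r n - x)) \<longlonglongrightarrow> d \<and> \<bar>d\<bar> \<le> \<epsilon>"
    if x: "0 < x" "x < X b" for x
  proof -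
    have "x \<in> X ` {a..b}" using X_image[of b] ab x by simp
    then obtain t where t: "t \<in> {a..b}" "x = X t" by blast
    have tt: "t \<in> {a<..<b}" using t x by (cases "t = a"; cases "t = b") auto
    obtain r where r: "\<forall>n. x < r n" "r \<longlonglongrightarrow> x"
      "(\<lambda>n. (K (r n) - K x) / (r n - x)) \<longlonglongrightarrow> hilfer \<mu> \<nu> \<Psi> \<Psi>' a b y t"
      using hilfer_right_derivative[OF \<mu> \<nu> \<rho> g ex tt, of K] unfolding t(2) K_def \<Phi>_def \<beta>_def by blast
    have "(J has_real_derivative x powr (\<rho> - 1) * f x) (at x)"
      unfolding J_def[abs_def] by (rule ek_int_one_has_derivative[OF \<rho>1(1) f(1) x])
    then have "((\<lambda>z. (J z - J x) / (z - x)) \<longlongrightarrow> h t) (at x)"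
      using f(2)[of t] tt t(2) by (simp add: has_field_derivative_iff)
    moreover have "filterlim r (at x) sequentially"
      unfolding filterlim_at using r(1,2) by (auto intro!: always_eventually simp: less_imp_neq neq_iff)
    ultimately have "(\<lambda>n. (J (r n) - J x) / (r n - x)) \<longlonglongrightarrow> h t"
      by (rule filterlim_compose)
    from tendsto_diff[OF r(3) this]
    have "(\<lambda>n. (D (r n) - D x) / (r n - x)) \<longlonglongrightarrow> hilfer \<mu> \<nu> \<Psi> \<Psi>' a b y t - h t"
      unfolding D_def diff_divide_distrib[symmetric] by (simp add: algebra_simps)
    then show ?thesis using r(1,2) le[of t] tt by (intro exI[of _ r] exI) auto
  qed
  show ?thesis
  proof (rule integral_equation_defect_bound[OF \<mu>(1) \<beta> _ \<rho>1(2) _ g(1) f(1) _ cD _ x])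
    show "\<bar>D z - D x\<bar> \<le> \<epsilon> * (z - x)" if "0 \<le> x" "x \<le> z" "z \<le> X b" for x z
      using Lipschitz_of_right_derivative_bound[OF cD seq that] .
  qed (use X_pos[of b] ab in \<open>auto simp: \<beta>_def D_def K_def J_def \<Phi>_def\<close>)
qed

end


section \<open>Picard iteration\<close>

text \<open>Each application of the Volterra operator raises the power of \<open>x\<close> by
  \<open>\<mu>\<close> while the Gamma quotients telescope, so the increments are summable without
  smallness of \<open>L\<close> or \<open>B\<close>. The first increment is the defect of
  \<open>g0\<close>; summing all of them bounds the distance from \<open>g0\<close> to the
  limit.\<close>

lemma picard_mittag_leffler:
  fixes \<mu> \<rho> L B \<epsilon> c :: real and N :: "(real \<Rightarrow> real) \<Rightarrow> real \<Rightarrow> real"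
  assumes \<mu>: "0 < \<mu>" and \<rho>: "0 < \<rho>" "\<rho> \<le> 1" and L: "0 < L" and B: "0 < B"
    and cN: "\<And>g. continuous_on {0..B} g \<Longrightarrow> continuous_on {0..B} (N g)"
    and LN: "\<And>g h s. continuous_on {0..B} g \<Longrightarrow> continuous_on {0..B} h \<Longrightarrow> 0 < s \<Longrightarrow> s \<le> B \<Longrightarrow>
      \<bar>N g s - N h s\<bar> \<le> L * \<bar>g s - h s\<bar>"
    and g0: "continuous_on {0..B} g0"
    and defect: "\<And>x. x \<in> {0..B} \<Longrightarrow>
      \<bar>g0 x - c - x powr \<mu> * ek_int \<mu> \<rho> (N g0) x\<bar> \<le> \<epsilon> / Gamma (1 + \<mu>) * x powr (\<mu> + 1 - \<rho>)"
  shows "\<exists>g. continuous_on {0..B} g \<and> (\<forall>x\<in>{0..B}. g x = c + x powr \<mu> * ek_int \<mu> \<rho> (N g) x) \<and>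
    (\<forall>x\<in>{0..B}. \<bar>g0 x - g x\<bar> \<le> (mittag_leffler \<mu> (L * B powr \<mu>) - 1) / L * B powr (1 - \<rho>) * \<epsilon>)"
proof -
  define T where "T g x = c + x powr \<mu> * ek_int \<mu> \<rho> (N g) x" for g x
  define G where "G n = (T ^^ n) g0" for n
  define z where "z = L * B powr \<mu>"
  \<comment> \<open>Up to a constant, term number \<open>n + 1\<close> of the Mittag-Leffler series;
    the missing term number 0 equals 1 and accounts for the \<open>- 1\<close> in the bound.\<close>
  define M where "M n = \<epsilon> * B powr (1 - \<rho>) / L * (z ^ Suc n / Gamma (real (Suc n) * \<mu> + 1))" for n
  have G_Suc: "G (Suc n) = T (G n)" for n by (simp add: G_def)
  have cT: "continuous_on {0..B} (T g)" if "continuous_on {0..B} g" for g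
    unfolding T_def using \<mu> \<rho> cN[OF that]
    by (intro continuous_on_add continuous_on_const continuous_on_powr_ek_int) auto
  have cG: "continuous_on {0..B} (G n)" for n
    by (induction n) (use g0 cT in \<open>auto simp: G_Suc, simp add: G_def\<close>)
  have \<epsilon>: "0 \<le> \<epsilon>"
  proof -
    have "0 \<le> \<epsilon> / Gamma (1 + \<mu>) * B powr (\<mu> + 1 - \<rho>)"
      using order_trans[OF abs_ge_zero defect[of B]] B by simp
    moreover have "0 < Gamma (1 + \<mu>)" using \<mu> by (intro Gamma_real_pos) auto
    ultimately show ?thesis using B by (simp add: zero_le_mult_iff zero_le_divide_iff)
  qed
  \<comment> \<open>Used with growing exponents \<open>q\<close> for the increments, and with
    \<open>q = 0\<close> for passing to the limit in the fixed point equation.\<close>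
  have T_diff: "\<bar>T g x - T h x\<bar> \<le> x powr \<mu> * (L * C * x powr q * (Gamma (\<rho> + q) / Gamma (\<rho> + q + \<mu>)))"
    if g: "continuous_on {0..B} g" and h: "continuous_on {0..B} h" and x: "0 < x" "x \<le> B" and q: "0 \<le> q"
      and le: "\<And>s. 0 < s \<Longrightarrow> s \<le> x \<Longrightarrow> \<bar>g s - h s\<bar> \<le> C * s powr q" for g h x C q
  proof -
    have "\<bar>ek_int \<mu> \<rho> (N g) x - ek_int \<mu> \<rho> (N h) x\<bar> = \<bar>ek_int \<mu> \<rho> (\<lambda>s. N g s - N h s) x\<bar>"
      using ek_int_diff[of \<mu> \<rho> B "N g" "N h" x] cN g h x \<mu> \<rho> by simp
    also have "\<dots> \<le> L * C * x powr q * (Gamma (\<rho> + q) / Gamma (\<rho> + q + \<mu>))"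
    proof (rule ek_int_bound)
      show "continuous_on {0..B} (\<lambda>s. N g s - N h s)" using cN g h by (intro continuous_on_diff) auto
      fix s assume s: "0 < s" "s \<le> x"
      have "\<bar>N g s - N h s\<bar> \<le> L * \<bar>g s - h s\<bar>" using LN g h s x by simp
      also have "\<dots> \<le> L * (C * s powr q)" using L le[OF s] by (intro mult_left_mono) auto
      finally show "\<bar>N g s - N h s\<bar> \<le> L * C * s powr q" by simp
    qed (use \<mu> \<rho> q x in auto)
    finally have "x powr \<mu> * \<bar>ek_int \<mu> \<rho> (N g) x - ek_int \<mu> \<rho> (N h) x\<bar>
        \<le> x powr \<mu> * (L * C * x powr q * (Gamma (\<rho> + q) / Gamma (\<rho> + q + \<mu>)))"
      by (intro mult_left_mono) auto
    moreover have "T g x - T h x = x powr \<mu> * (ek_int \<mu> \<rho> (N g) x - ek_int \<mu> \<rho> (N h) x)"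
      by (simp add: T_def right_diff_distrib)
    ultimately show ?thesis by (simp add: abs_mult)
  qed
  have incr: "\<bar>G (Suc n) x - G n x\<bar>
      \<le> \<epsilon> * L ^ n / Gamma (real (Suc n) * \<mu> + 1) * x powr (real (Suc n) * \<mu> + 1 - \<rho>)"
    if "0 \<le> x" "x \<le> B" for n x
    using that
  proof (induction n arbitrary: x)
    case 0
    then show ?case using defect[of x] by (simp add: G_def T_def abs_minus_commute add.commute algebra_simps)
  next
    case (Suc n)
    show ?case
    proof (cases "x = 0")
      \<comment> \<open>Because \<open>0 powr \<mu> = 0\<close>, all iterates after the start equal
        \<open>c\<close> at 0.\<close>
      case True
      then show ?thesis by (simp add: G_Suc[of "Suc n"] G_Suc[of n] T_def)
    next
      case False
      define C where "C = \<epsilon> * L ^ n / Gamma (real (Suc n) * \<mu> + 1)"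
      define q where "q = real (Suc n) * \<mu> + 1 - \<rho>"
      have pos: "Gamma (real (Suc n) * \<mu> + 1) > 0" using \<mu> by (intro Gamma_real_pos) (auto intro: add_nonneg_pos)
      have "0 \<le> real (Suc n) * \<mu>" using \<mu> by simp
      then have q: "0 \<le> q" using \<rho> unfolding q_def by linarith
      have "\<bar>T (G (Suc n)) x - T (G n) x\<bar> \<le> x powr \<mu> * (L * C * x powr q * (Gamma (\<rho> + q) / Gamma (\<rho> + q + \<mu>)))"
        using Suc False cG q by (intro T_diff) (auto simp: C_def q_def)
      also have "\<dots> = L * (C * Gamma (\<rho> + q)) / Gamma (\<rho> + q + \<mu>) * (x powr \<mu> * x powr q)" by simp
      \<comment> \<open>Here \<open>\<rho> + q\<close> equals
        \<open>real (Suc n) * \<mu> + 1\<close>, so the Gamma factor cancels the denominator of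
        \<open>C\<close>.\<close>
      also have "C * Gamma (\<rho> + q) = \<epsilon> * L ^ n" unfolding C_def q_def using pos by simp
      also have "\<rho> + q + \<mu> = real (Suc (Suc n)) * \<mu> + 1" by (simp add: q_def algebra_simps)
      also have "x powr \<mu> * x powr q = x powr (real (Suc (Suc n)) * \<mu> + 1 - \<rho>)"
        unfolding powr_add[symmetric] q_def by (rule arg_cong[where f = "(powr) x"]) (simp add: algebra_simps)
      finally show ?thesis by (simp add: G_Suc mult_ac)
    qed
  qed
  have incr_M: "norm (G (Suc n) x - G n x) \<le> M n" if x: "x \<in> {0..B}" for n x
  proof -
    have pos: "Gamma (real (Suc n) * \<mu> + 1) > 0" using \<mu> by (intro Gamma_real_pos) (auto intro: add_nonneg_pos)
    have "norm (G (Suc n) x - G n x)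
      \<le> \<epsilon> * L ^ n / Gamma (real (Suc n) * \<mu> + 1) * x powr (real (Suc n) * \<mu> + 1 - \<rho>)"
      using incr[of x n] x by simp
    also have "\<dots> \<le> \<epsilon> * L ^ n / Gamma (real (Suc n) * \<mu> + 1) * B powr (real (Suc n) * \<mu> + 1 - \<rho>)"
    proof (intro mult_left_mono powr_mono2)
      have "0 \<le> real (Suc n) * \<mu>" using \<mu> by simp
      then show "0 \<le> real (Suc n) * \<mu> + 1 - \<rho>" using \<rho> by linarith
    qed (use \<epsilon> L pos x in auto)
    also have "B powr (real (Suc n) * \<mu> + 1 - \<rho>) = (B powr \<mu>) ^ Suc n * B powr (1 - \<rho>)"
    proof -
      have "B powr (real (Suc n) * \<mu> + 1 - \<rho>) = B powr (\<mu> * real (Suc n) + (1 - \<rho>))" by (simp add: algebra_simps)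
      also have "\<dots> = (B powr \<mu>) powr real (Suc n) * B powr (1 - \<rho>)" by (simp only: powr_add powr_powr)
      also have "(B powr \<mu>) powr real (Suc n) = (B powr \<mu>) ^ Suc n" using B by (intro powr_realpow) auto
      finally show ?thesis .
    qed
    also have "\<epsilon> * L ^ n / Gamma (real (Suc n) * \<mu> + 1) * ((B powr \<mu>) ^ Suc n * B powr (1 - \<rho>)) = M n"
      unfolding M_def z_def power_mult_distrib using L by simp
    finally show ?thesis .
  qed
  have z: "0 \<le> z" using L by (simp add: z_def)
  have sm: "summable (\<lambda>k. z ^ k / Gamma (real k * \<mu> + 1))" by (rule summable_mittag_leffler[OF \<mu> z])
  then have sm': "summable (\<lambda>n. z ^ Suc n / Gamma (real (Suc n) * \<mu> + 1))"
    by (subst summable_Suc_iff)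
  have sM: "summable M" unfolding M_def by (rule summable_mult[OF sm'])
  have sumM: "suminf M = (mittag_leffler \<mu> (L * B powr \<mu>) - 1) / L * B powr (1 - \<rho>) * \<epsilon>"
  proof -
    have "suminf M = \<epsilon> * B powr (1 - \<rho>) / L * (\<Sum>n. z ^ Suc n / Gamma (real (Suc n) * \<mu> + 1))"
      unfolding M_def by (rule suminf_mult[OF sm'])
    also have "(\<Sum>n. z ^ Suc n / Gamma (real (Suc n) * \<mu> + 1)) = mittag_leffler \<mu> z - 1"
      unfolding mittag_leffler_def using suminf_split_head[OF sm] by simp
    finally show ?thesis by (simp add: z_def)
  qed
  define S where "S x = (\<Sum>i. G (Suc i) x - G i x)" for x
  define g where "g x = g0 x + S x" for x
  have ul: "uniform_limit {0..B} (\<lambda>n x. \<Sum>i<n. G (Suc i) x - G i x) S sequentially"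
    unfolding S_def by (rule Weierstrass_m_test[OF incr_M sM])
  have "uniform_limit {0..B} (\<lambda>n x. g0 x + (\<Sum>i<n. G (Suc i) x - G i x)) g sequentially"
    unfolding g_def by (intro uniform_limit_add ul uniform_limit_const)
  moreover have "g0 x + (\<Sum>i<n. G (Suc i) x - G i x) = G n x" for n x
    using sum_lessThan_telescope[of "\<lambda>i. G i x" n] by (simp add: G_def)
  ultimately have ulG: "uniform_limit {0..B} G g sequentially" by simp
  have cg: "continuous_on {0..B} g"
    by (rule uniform_limit_theorem[OF _ ulG]) (use cG in auto)
  have bound: "\<bar>g0 x - g x\<bar> \<le> suminf M" if "x \<in> {0..B}" for x
    using norm_suminf_le[OF incr_M[OF that] sM] by (simp add: g_def S_def)
  have fixp: "g x = T g x" if x: "x \<in> {0..B}" for x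
  proof (cases "x = 0")
    case True
    have "(\<lambda>n. G n x) \<longlonglongrightarrow> g x" by (rule tendsto_uniform_limitI[OF ulG x])
    then have "(\<lambda>n. G (Suc n) x) \<longlonglongrightarrow> g x" by (rule LIMSEQ_Suc)
    moreover have "G (Suc n) x = c" for n using True by (simp add: G_Suc T_def)
    ultimately have "g x = c" by (simp add: LIMSEQ_const_iff)
    then show ?thesis using True by (simp add: T_def)
  next
    case False
    then have x': "0 < x" "x \<le> B" using x by auto
    \<comment> \<open>A Lipschitz constant of \<open>T\<close> at \<open>x\<close> in the sup norm,
      from \<open>T_diff\<close> with \<open>q = 0\<close>; uniform convergence of \<open>G\<close>
      therefore passes through \<open>T\<close>.\<close>
    define K where "K = x powr \<mu> * (L * (Gamma \<rho> / Gamma (\<rho> + \<mu>)))"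
    have K: "0 < K" unfolding K_def using x' L \<mu> \<rho>
      by (intro mult_pos_pos divide_pos_pos Gamma_real_pos) auto
    have "(\<lambda>n. T (G n) x) \<longlonglongrightarrow> T g x"
    proof (rule LIMSEQ_I)
      fix e :: real assume e: "0 < e"
      then have "0 < e / (2 * K)" using K by simp
      from uniform_limitD[OF ulG this] obtain n0 where
        n0: "\<And>n y. n \<ge> n0 \<Longrightarrow> y \<in> {0..B} \<Longrightarrow> dist (G n y) (g y) < e / (2 * K)"
        unfolding eventually_sequentially by blast
      have "norm (T (G n) x - T g x) < e" if "n \<ge> n0" for n
      proof -
        have "\<bar>T (G n) x - T g x\<bar> \<le> x powr \<mu> * (L * (e / (2 * K)) * x powr 0 * (Gamma (\<rho> + 0) / Gamma (\<rho> + 0 + \<mu>)))"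
        proof (rule T_diff[OF cG cg x'])
          fix s assume "0 < s" "s \<le> x"
          then show "\<bar>G n s - g s\<bar> \<le> e / (2 * K) * s powr 0"
            using n0[OF that, of s] x' by (simp add: dist_real_def)
        qed simp
        also have "\<dots> = K * (e / (2 * K))" using x' by (simp add: K_def)
        also have "\<dots> < e" using K e by simp
        finally show ?thesis by simp
      qed
      then show "\<exists>no. \<forall>n\<ge>no. norm (T (G n) x - T g x) < e" by blast
    qed
    moreover have "(\<lambda>n. T (G n) x) \<longlonglongrightarrow> g x"
      using LIMSEQ_Suc[OF tendsto_uniform_limitI[OF ulG x]] by (simp add: G_Suc)
    ultimately show ?thesis by (rule LIMSEQ_unique[rotated])
  qed
  show ?thesis
    using cg fixp bound unfolding sumM T_def by (intro exI[of _ g]) auto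
qed


section \<open>Positivity of \<Psi>' and the stability theorem\<close>

lemma deriv_pos_of_mono:
  fixes \<Psi> :: "real \<Rightarrow> real"
  assumes "a < b" and "\<And>t. t \<in> {a..b} \<Longrightarrow> (\<Psi> has_real_derivative \<Psi>' t) (at t within {a..b})"
    and "continuous_on {a..b} \<Psi>'" "mono_on {a..b} \<Psi>" "\<And>t. t \<in> {a..b} \<Longrightarrow> \<Psi>' t \<noteq> 0" "t \<in> {a..b}"
  shows "0 < \<Psi>' t"
proof -
  have "0 \<le> \<Psi>' t"
  \<comment> \<open>Monotonicity gives the sign inside the interval and continuity of
    \<open>\<Psi>'\<close> at its ends; strictness then comes from nonvanishing.\<close>
  proof (rule continuous_ge_on_closure[of "{a<..<b}" \<Psi>'])
    fix s assume s: "s \<in> {a<..<b}"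
    then have "(\<Psi> has_real_derivative \<Psi>' s) (at s)"
      using assms(2)[of s] at_within_Icc_at[of a s b] by auto
    then show "0 \<le> \<Psi>' s"
      using mono_on_imp_deriv_nonneg[OF assms(4)] s by auto
  qed (use assms in auto)
  then show ?thesis using assms(5)[OF assms(6)] by simp
qed

theorem theorem4p1:
  fixes a b \<mu> \<nu> \<rho> L \<epsilon> :: real
    and \<Psi> \<Psi>' :: "real \<Rightarrow> real"
    and f :: "real \<Rightarrow> real \<Rightarrow> real"
    and ystar :: "real \<Rightarrow> real"
  assumes "0 < a" and "a < b"
    and "\<forall>t\<in>{a..b}. (\<Psi> has_real_derivative \<Psi>' t) (at t within {a..b})"
    and "continuous_on {a..b} \<Psi>'"
    and "mono_on {a..b} \<Psi>"
    and "\<forall>t\<in>{a..b}. \<Psi>' t \<noteq> 0"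
    and "0 < \<mu>" and "\<mu> < 1" and "0 \<le> \<nu>" and "\<nu> \<le> 1"
    and "\<rho> = \<mu> + \<nu> - \<mu> * \<nu>"
    and "\<forall>y. wC \<Psi> a b \<rho> y \<longrightarrow> wC \<Psi> a b \<rho> (\<lambda>t. f t (y t))"
    and "0 < L"
    and "\<forall>t\<in>{a<..b}. \<forall>y1 y2. \<bar>f t y1 - f t y2\<bar> \<le> L * \<bar>y1 - y2\<bar>"
    and "0 < \<epsilon>"
    and "wC \<Psi> a b \<rho> ystar"
    and "hilfer_exists \<mu> \<nu> \<Psi> \<Psi>' a b ystar"
    and "\<forall>t\<in>{a<..b}. \<bar>hilfer \<mu> \<nu> \<Psi> \<Psi>' a b ystar t - f t (ystar t)\<bar> \<le> \<epsilon>"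
  shows "\<exists>y c. ((frac_int (1 - \<rho>) \<Psi> \<Psi>' a ystar) \<longlongrightarrow> c) (at_right a)
           \<and> wC \<Psi> a b \<rho> y
           \<and> (\<forall>t\<in>{a<..b}. y t = (\<Psi> t - \<Psi> a) powr (\<rho> - 1) / Gamma \<rho> * c
                                + frac_int \<mu> \<Psi> \<Psi>' a (\<lambda>s. f s (y s)) t)
           \<and> wC_norm \<Psi> a b \<rho> (\<lambda>t. ystar t - y t)
               \<le> ((mittag_leffler \<mu> (L * (\<Psi> b - \<Psi> a) powr \<mu>) - 1) / L
                   * (\<Psi> b - \<Psi> a) powr (1 - \<rho>)) * \<epsilon>"
proof -
  interpret psi_scale a b \<Psi> \<Psi>'
  proof
    show "0 < \<Psi>' t" if "t \<in> {a..b}" for t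
      using deriv_pos_of_mono[of a b \<Psi> \<Psi>' t] assms(2-6) that by blast
  qed (use assms in auto)
  note \<mu> = assms(7,8) and \<nu> = assms(9,10) and \<rho> = assms(11)
  define B where "B = X b"
  have B: "0 < B" using X_pos[of b] ab by (simp add: B_def)
  have "0 \<le> (1 - \<nu>) * (1 - \<mu>)" "0 \<le> \<nu> * (1 - \<mu>)" using \<mu> \<nu> by auto
  then have \<rho>1: "0 < \<rho>" "\<rho> \<le> 1" unfolding \<rho> using \<mu> by (simp_all add: algebra_simps)
  have Xmem: "X t \<in> {0..B}" "0 < X t" if "t \<in> {a<..b}" for t
    using X_pos[of t] X_le[of t b] that by (auto simp: B_def)
  obtain g0 where g0: "continuous_on {0..B} g0" "\<And>t. t \<in> {a<..b} \<Longrightarrow> ystar t = X t powr (\<rho> - 1) * g0 (X t)"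
    using assms(16) unfolding wC_iff B_def by blast
  \<comment> \<open>The superposition operator of \<open>f\<close>, transported to continuous
    functions on \<open>{0..B}\<close>: choosing such an \<open>h\<close> for every \<open>g\<close>
    defines the map \<open>N\<close> that the Picard iteration uses.\<close>
  have "\<exists>h. continuous_on {0..B} h \<and> (\<forall>t\<in>{a<..b}. f t (X t powr (\<rho> - 1) * g (X t)) = X t powr (\<rho> - 1) * h (X t))"
    if "continuous_on {0..B} g" for g
  proof -
    have "wC \<Psi> a b \<rho> (\<lambda>t. X t powr (\<rho> - 1) * g (X t))" using that unfolding wC_iff B_def by blast
    then have "wC \<Psi> a b \<rho> (\<lambda>t. f t (X t powr (\<rho> - 1) * g (X t)))" using assms(12) by blast
    then show ?thesis unfolding wC_iff B_def .
  qed
  then obtain N where N: "\<And>g. continuous_on {0..B} g \<Longrightarrow> continuous_on {0..B} (N g)"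
    "\<And>g t. continuous_on {0..B} g \<Longrightarrow> t \<in> {a<..b} \<Longrightarrow>
       f t (X t powr (\<rho> - 1) * g (X t)) = X t powr (\<rho> - 1) * N g (X t)"
    by metis
  \<comment> \<open>The Lipschitz condition is homogeneous, so the weight
    \<open>s powr (\<rho> - 1)\<close> cancels. Only \<open>s > 0\<close> is covered because
    \<open>f\<close> is constrained on \<open>{a<..b}\<close>.\<close>
  have LN: "\<bar>N g s - N h s\<bar> \<le> L * \<bar>g s - h s\<bar>"
    if g: "continuous_on {0..B} g" and h: "continuous_on {0..B} h" and s: "0 < s" "s \<le> B" for g h s
  proof -
    have "s \<in> X ` {a..b}" using s X_image[of b] ab by (simp add: B_def)
    then obtain t where t: "t \<in> {a..b}" "s = X t" by blast
    then have t': "t \<in> {a<..b}" using s by (cases "t = a") auto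
    have w: "0 < s powr (\<rho> - 1)" using s by simp
    have "s powr (\<rho> - 1) * \<bar>N g s - N h s\<bar> = \<bar>f t (s powr (\<rho> - 1) * g s) - f t (s powr (\<rho> - 1) * h s)\<bar>"
      using N(2)[OF g t'] N(2)[OF h t'] by (simp add: t(2) abs_mult flip: right_diff_distrib)
    also have "\<dots> \<le> L * \<bar>s powr (\<rho> - 1) * g s - s powr (\<rho> - 1) * h s\<bar>"
      using assms(14) t' by blast
    also have "\<dots> = s powr (\<rho> - 1) * (L * \<bar>g s - h s\<bar>)"
      by (simp add: abs_mult flip: right_diff_distrib)
    finally show ?thesis using w by simp
  qed
  have "\<bar>g0 x - g0 0 - x powr \<mu> * ek_int \<mu> \<rho> (N g0) x\<bar> \<le> \<epsilon> / Gamma (1 + \<mu>) * x powr (\<mu> + 1 - \<rho>)"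
    if x: "x \<in> {0..B}" for x
  proof (rule hilfer_defect_bound[OF \<mu> \<nu> \<rho>])
    show "\<bar>hilfer \<mu> \<nu> \<Psi> \<Psi>' a b ystar t - f t (ystar t)\<bar> \<le> \<epsilon>" if "t \<in> {a<..b}" for t
      using assms(18) that by blast
    show "f t (ystar t) = X t powr (\<rho> - 1) * N g0 (X t)" if "t \<in> {a<..b}" for t
      using N(2)[OF g0(1) that] g0(2)[OF that] by simp
  qed (use g0 N assms(17) x in \<open>auto simp: B_def\<close>)
  from picard_mittag_leffler[OF \<mu>(1) \<rho>1 assms(13) B N(1) LN g0(1) this]
  obtain g where g: "continuous_on {0..B} g" "\<And>x. x \<in> {0..B} \<Longrightarrow> g x = g0 0 + x powr \<mu> * ek_int \<mu> \<rho> (N g) x"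
    "\<And>x. x \<in> {0..B} \<Longrightarrow> \<bar>g0 x - g x\<bar> \<le> (mittag_leffler \<mu> (L * B powr \<mu>) - 1) / L * B powr (1 - \<rho>) * \<epsilon>"
    by blast
  define y where "y t = X t powr (\<rho> - 1) * g (X t)" for t
  \<comment> \<open>The limit at \<open>a\<close> of the fractional integral of order
    \<open>1 - \<rho>\<close> of \<open>ystar\<close>, read off from \<open>ek_int_at_zero\<close>;
    the initial term of the equation then becomes the weight times \<open>g0 0\<close>.\<close>
  define c where "c = g0 0 * Gamma \<rho>"
  have G: "Gamma \<rho> \<noteq> 0" using Gamma_real_pos[OF \<rho>1(1)] by linarith
  have "((frac_int (1 - \<rho>) \<Psi> \<Psi>' a ystar) \<longlongrightarrow> c) (at_right a)"
  proof -
    define \<Phi> where "\<Phi> = ek_int (1 - \<rho>) \<rho> g0"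
    have "continuous_on {0..B} \<Phi>"
      unfolding \<Phi>_def using \<rho>1 g0(1) by (intro continuous_on_ek_int) auto
    then have "continuous_on {a..b} (\<lambda>t. \<Phi> (X t))"
      using continuous_on_compose2[OF _ continuous_on_X] X_image[of b] ab by (auto simp: B_def)
    then have "((\<lambda>t. \<Phi> (X t)) \<longlongrightarrow> \<Phi> (X a)) (at a within {a..b})"
      using ab by (auto simp: continuous_on_def simp del: X_a)
    moreover have "\<Phi> (X a) = c"
      using ek_int_at_zero[of "1 - \<rho>" \<rho> g0] \<rho>1 by (simp add: \<Phi>_def c_def)
    ultimately have "((\<lambda>t. \<Phi> (X t)) \<longlongrightarrow> c) (at_right a)"
      using at_within_Icc_at_right[OF ab] by simp
    \<comment> \<open>The value of \<open>frac_int\<close> at \<open>a\<close> itself need not be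
      the limit, so the two functions are compared for \<open>t > a\<close> only.\<close>
    moreover have "\<forall>\<^sub>F t in at_right a. \<Phi> (X t) = frac_int (1 - \<rho>) \<Psi> \<Psi>' a ystar t"
      unfolding eventually_at_right[OF ab]
    proof (intro exI[of _ b] conjI allI impI)
      fix t assume "a < t" "t < b"
      then have t: "t \<in> {a<..b}" by auto
      have "frac_int (1 - \<rho>) \<Psi> \<Psi>' a ystar t = X t powr (1 - \<rho> + \<rho> - 1) * \<Phi> (X t)"
        unfolding \<Phi>_def using t \<rho>1 g0 by (intro frac_int_eq) (auto simp: B_def)
      then show "\<Phi> (X t) = frac_int (1 - \<rho>) \<Psi> \<Psi>' a ystar t" using Xmem(2)[OF t] by simp
    qed (rule ab)
    ultimately show ?thesis by (rule Lim_transform_eventually)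
  qed
  moreover have "wC \<Psi> a b \<rho> y"
    unfolding wC_iff using g(1) by (auto simp: y_def B_def)
  moreover have "y t = (\<Psi> t - \<Psi> a) powr (\<rho> - 1) / Gamma \<rho> * c + frac_int \<mu> \<Psi> \<Psi>' a (\<lambda>s. f s (y s)) t"
    if t: "t \<in> {a<..b}" for t
  proof -
    have "frac_int \<mu> \<Psi> \<Psi>' a (\<lambda>s. f s (y s)) t = X t powr (\<mu> + \<rho> - 1) * ek_int \<mu> \<rho> (N g) (X t)"
    proof (rule frac_int_eq[OF t])
      show "f s (y s) = X s powr (\<rho> - 1) * N g (X s)" if "s \<in> {a<..t}" for s
        unfolding y_def using N(2)[OF g(1)] that t by auto
    qed (use \<mu> \<rho>1 N(1)[OF g(1)] in \<open>auto simp: B_def\<close>)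
    moreover have "X t powr (\<mu> + \<rho> - 1) = X t powr (\<rho> - 1) * X t powr \<mu>"
      unfolding powr_add[symmetric] by (simp add: algebra_simps)
    ultimately have "frac_int \<mu> \<Psi> \<Psi>' a (\<lambda>s. f s (y s)) t
        = X t powr (\<rho> - 1) * (X t powr \<mu> * ek_int \<mu> \<rho> (N g) (X t))" by simp
    moreover have "y t = X t powr (\<rho> - 1) * (g0 0 + X t powr \<mu> * ek_int \<mu> \<rho> (N g) (X t))"
      unfolding y_def using g(2)[OF Xmem(1)[OF t]] by simp
    moreover have "(\<Psi> t - \<Psi> a) powr (\<rho> - 1) / Gamma \<rho> * c = X t powr (\<rho> - 1) * g0 0"
      using G by (simp add: c_def X_def)
    ultimately show ?thesis by (simp add: distrib_left)
  qed
  moreover have "wC_norm \<Psi> a b \<rho> (\<lambda>t. ystar t - y t)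
      \<le> ((mittag_leffler \<mu> (L * (\<Psi> b - \<Psi> a) powr \<mu>) - 1) / L * (\<Psi> b - \<Psi> a) powr (1 - \<rho>)) * \<epsilon>"
    unfolding wC_norm_def
  proof (rule cSUP_least)
    show "{a<..b} \<noteq> {}" using ab by auto
    fix t assume t: "t \<in> {a<..b}"
    \<comment> \<open>The weights cancel, which reduces the weighted norm to the supremum of
      \<open>\<bar>g0 x - g x\<bar>\<close>.\<close>
    have "X t powr (1 - \<rho>) * X t powr (\<rho> - 1) = 1"
      using Xmem(2)[OF t] by (simp flip: powr_add)
    moreover have "X t powr (1 - \<rho>) * (ystar t - y t) = (X t powr (1 - \<rho>) * X t powr (\<rho> - 1)) * (g0 (X t) - g (X t))"
      unfolding g0(2)[OF t] y_def by (simp add: algebra_simps)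
    ultimately have "\<bar>X t powr (1 - \<rho>) * (ystar t - y t)\<bar> = \<bar>g0 (X t) - g (X t)\<bar>" by simp
    then show "\<bar>(\<Psi> t - \<Psi> a) powr (1 - \<rho>) * (ystar t - y t)\<bar>
      \<le> ((mittag_leffler \<mu> (L * (\<Psi> b - \<Psi> a) powr \<mu>) - 1) / L * (\<Psi> b - \<Psi> a) powr (1 - \<rho>)) * \<epsilon>"
      using g(3)[OF Xmem(1)[OF t]] by (simp add: B_def X_def)
  qed
  ultimately show ?thesis by blast
qed

end
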